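(* Consider a sequence of community detection problems indexed by $N\to\infty$ with parameters $n,p_0,p_1$ (depending on $N$) satisfying the standing assumptions of the context. Assume that $$\frac{n}{\log N}\to\infty \qquad\text{and}\qquad \log\Big(1\vee\frac{1}{np_0}\Big)=o\Big[\log\Big(\frac Nn\Big)\Big].$$ If $$\frac{p_1-p_0}{\sqrt{p_0}}\,\frac{n^2}{N}\to 0 \qquad\text{and}\qquad \limsup \frac{n\,H_{p_0}(p_1)}{2\log(N/n)}<1,$$ then all tests are asymptotically powerless, i.e. $\inf_T\gamma_N(T)\to1$, where the infimum is over all tests $T$ (equivalently, $\liminf_N\gamma_N(T_N)\ge1$ for every sequence of tests $(T_N)$).
   Context: Observed data: the adjacency matrix $\boldsymbol{W}=(W_{i,j})\in\{0,1\}^{N\times N}$ (symmetric, zero diagonal) of a random undirected graph on the node set $\{1,\dots,N\}$. Let $0<p_0<p_1\le 1$. Under $\mathbb{P}_0$ (null), the $W_{i,j}$, $i<j$, are i.i.d. Bernoulli$(p_0)$. For $S\subset\{1,\dots,N\}$ with $|S|=n$, under $\mathbb{P}_S$ (alternative), the $W_{i,j}$, $i<j$, are independent, $\mathbb{P}_S(W_{i,j}=1)=p_1$ if $i,j\in S$, and $=p_0$ otherwise. A test $T$ is a function of $\boldsymbol{W}$ with values in $\{0,1\}$ (it may depend on $N,n,p_0,p_1$), and its risk is $\gamma_N(T)=\mathbb{P}_0(T=1)+\max_{|S|=n}\mathbb{P}_S(T=0)$. Entropy function: $H_p(q)=q\log\frac qp+(1-q)\log\frac{1-q}{1-p}$ (with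 $0\log 0=0$). Standing assumptions: $N\to\infty$; $n,p_0,p_1$ may depend on $N$; $n/N\to0$; $p_0$ is bounded away from $1$; $N^2p_0\to\infty$; and $n\to\infty$ with $n^2p_1\to\infty$. *)

theory Defs
  imports "HOL-Probability.Probability" "HOL-Probability.Product_PMF" "HOL-Library.Landau_Symbols"
begin

definition node_pairs :: "nat \<Rightarrow> (nat \<times> nat) set" where
  "node_pairs N = {(i, j). 1 \<le> i \<and> i < j \<and> j \<le> N}"

text \<open>
  An $N \times N$ matrix over the node set $\{1,\dots,N\}$ is a function that vanishes outside
  the index range, so that it is determined by its $N^2$ entries.
\<close>

definition adjacency_matrices :: "nat \<Rightarrow> (nat \<Rightarrow> nat \<Rightarrow> nat) set" where
  "adjacency_matrices N =
    {W. (\<forall>i j. W i j \<in> {0, 1}) \<and> (\<forall>i j. W i j = W j i) \<and> (\<forall>i. W i i = 0) \<and>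
        (\<forall>i j. i \<notin> {1..N} \<or> j \<notin> {1..N} \<longrightarrow> W i j = 0)}"

definition adjacency_matrix :: "nat \<Rightarrow> (nat \<times> nat \<Rightarrow> bool) \<Rightarrow> nat \<Rightarrow> nat \<Rightarrow> nat" where
  "adjacency_matrix N e =
    (\<lambda>i j. of_bool ((i, j) \<in> node_pairs N \<and> e (i, j) \<or> (j, i) \<in> node_pairs N \<and> e (j, i)))"

definition null_law :: "nat \<Rightarrow> real \<Rightarrow> (nat \<Rightarrow> nat \<Rightarrow> nat) pmf" where
  "null_law N p0 =
    map_pmf (adjacency_matrix N) (Pi_pmf (node_pairs N) False (\<lambda>_. bernoulli_pmf p0))"

definition alt_law :: "nat \<Rightarrow> real \<Rightarrow> real \<Rightarrow> nat set \<Rightarrow> (nat \<Rightarrow> nat \<Rightarrow> nat) pmf" where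
  "alt_law N p0 p1 S =
    map_pmf (adjacency_matrix N)
      (Pi_pmf (node_pairs N) False
        (\<lambda>(i, j). bernoulli_pmf (if i \<in> S \<and> j \<in> S then p1 else p0)))"

definition tests :: "nat \<Rightarrow> ((nat \<Rightarrow> nat \<Rightarrow> nat) \<Rightarrow> nat) set" where
  "tests N = adjacency_matrices N \<rightarrow> {0, 1}"

text \<open>
  The maximum is over a nonempty set exactly if $n \le N$. This holds for all large $N$ when
  $n/N \to 0$, so the unspecified value of \<^const>\<open>Max\<close> on the empty set plays no role in limits.
\<close>

definition risk :: "nat \<Rightarrow> nat \<Rightarrow> real \<Rightarrow> real \<Rightarrow> ((nat \<Rightarrow> nat \<Rightarrow> nat) \<Rightarrow> nat) \<Rightarrow> real" where
  "risk N n p0 p1 T =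
    measure_pmf.prob (null_law N p0) {W. T W = 1} +
    (MAX S\<in>{S. S \<subseteq> {1..N} \<and> card S = n}. measure_pmf.prob (alt_law N p0 p1 S) {W. T W = 0})"

text \<open>The convention $0 \log 0 = 0$ holds automatically, since any product with factor $0$ is $0$.\<close>

definition bernoulli_entropy :: "real \<Rightarrow> real \<Rightarrow> real" where
  "bernoulli_entropy p q = q * ln (q / p) + (1 - q) * ln ((1 - q) / (1 - p))"

lemma finite_node_pairs [simp]: "finite (node_pairs N)"
  by (rule finite_subset[of _ "{1..N} \<times> {1..N}"]) (auto simp: node_pairs_def)

lemma adjacency_matrix_in: "adjacency_matrix N e \<in> adjacency_matrices N"
  by (auto simp: adjacency_matrix_def adjacency_matrices_def node_pairs_def)

lemma set_null_law: "set_pmf (null_law N p0) \<subseteq> adjacency_matrices N"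
  by (auto simp: null_law_def adjacency_matrix_in)

lemma set_alt_law: "set_pmf (alt_law N p0 p1 S) \<subseteq> adjacency_matrices N"
  by (auto simp: alt_law_def adjacency_matrix_in)

lemma map_alt_law_entry:
  assumes "1 \<le> i" "i < j" "j \<le> N"
  shows "map_pmf (\<lambda>W. W i j) (alt_law N p0 p1 S) =
         map_pmf of_bool (bernoulli_pmf (if i \<in> S \<and> j \<in> S then p1 else p0))"
proof -
  have ij: "(i, j) \<in> node_pairs N" using assms by (simp add: node_pairs_def)
  have ji: "(j, i) \<notin> node_pairs N" using assms by (simp add: node_pairs_def)
  have "map_pmf (\<lambda>W. W i j) (alt_law N p0 p1 S) =
      map_pmf of_bool (map_pmf (\<lambda>e. e (i, j)) (Pi_pmf (node_pairs N) False
        (\<lambda>(i, j). bernoulli_pmf (if i \<in> S \<and> j \<in> S then p1 else p0))))"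
    by (simp add: alt_law_def map_pmf_comp adjacency_matrix_def ij ji)
  also have "\<dots> = map_pmf of_bool (bernoulli_pmf (if i \<in> S \<and> j \<in> S then p1 else p0))"
    using ij by (simp add: Pi_pmf_component)
  finally show ?thesis .
qed

lemma bdd_below_risk:
  assumes "n \<le> N"
  shows "bdd_below (risk N n p0 p1 ` A)"
proof -
  obtain S where S: "S \<subseteq> {1..N}" "card S = n"
    using assms obtain_subset_with_card_n[of n "{1..N}"] by auto
  have "0 \<le> risk N n p0 p1 T" for T
  proof -
    let ?F = "\<lambda>S. measure_pmf.prob (alt_law N p0 p1 S) {W. T W = 0}"
    have "?F S \<le> Max (?F ` {S. S \<subseteq> {1..N} \<and> card S = n})"
      using S by (intro Max_ge) auto
    then show ?thesis
      unfolding risk_def using measure_nonneg by (smt (verit))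
  qed
  then show ?thesis by (intro bdd_belowI2[of A 0])
qed

end

theory Submission
  imports Defs "HOL-Real_Asymp.Real_Asymp"
begin

text \<open>
  Write \<open>L T\<close> for the likelihood ratio of the subgraph on the node set \<open>T\<close>. The lower bound on
  the risk follows from the second moment method applied to the mixture over \<open>S\<close> of \<open>L S\<close>, truncated
  to the event that \<open>L T \<le> (N / n) ^ card T\<close> for every \<open>T \<subseteq> S\<close> with \<open>card T \<ge> b n\<^sup>2 / N\<close>. With this choice of
  the truncation level a single family of numbers controls both moments. For any exponent \<open>s\<close> between
  \<open>0\<close> and \<open>1\<close> (which may depend on \<open>k = card T\<close>), Markov's inequality for \<open>L T powr s\<close> bounds the loss
  in the first moment by the sum over \<open>k\<close> of
  \<open>(n choose k) * (n / N) powr (s * k) * (E\<^sub>0 lr powr (1 + s)) ^ (k choose 2)\<close>,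
  where \<open>lr\<close> is the likelihood ratio of one edge. On the truncation event
  \<open>(L T)\<^sup>2 \<le> (N / n) powr (k * (1 - s)) * L T powr (1 + s)\<close>, and two communities
  share at least a given set of \<open>k\<close> nodes with probability at most \<open>(n / N) ^ k\<close>, so the large overlaps contribute
  at most the same sum to the second moment. Overlaps below \<open>b n\<^sup>2 / N\<close> contribute \<open>1 + o(1)\<close> by the
  condition on the total degree.

  Since \<open>ln (E\<^sub>0 lr powr (1 + s)) \<le> s H (1 + O(s (1 + l) exp (s l)))\<close> with
  \<open>l = ln (p1 / p0) = o(ln (N / n))\<close>, the sum is small with \<open>s = 1\<close> when \<open>k / n\<close> is below a small power of
  \<open>n / N\<close>, and with \<open>s\<close> proportional to \<open>(ln (n / k) + const) / ln (N / n)\<close> otherwise.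
\<close>

subsection \<open>Counting subsets\<close>

lemma sum_Pow_card:
  fixes g :: "nat \<Rightarrow> real"
  assumes "finite S"
  shows "(\<Sum>T\<in>Pow S. g (card T)) = (\<Sum>k\<le>card S. real (card S choose k) * g k)"
proof -
  have "(\<Sum>k\<le>card S. \<Sum>T\<in>{T \<in> Pow S. card T = k}. g (card T)) = (\<Sum>T\<in>Pow S. g (card T))"
    using assms by (intro sum.group) (auto intro: card_mono)
  moreover have "(\<Sum>T\<in>{T \<in> Pow S. card T = k}. g (card T)) = real (card S choose k) * g k" for k
    by (simp add: n_subsets[OF assms, symmetric])
  ultimately show ?thesis by (simp cong: sum.cong)
qed

lemma card_supersets:
  assumes "finite A" "T \<subseteq> A" "card T \<le> n"
  shows "card {S. S \<subseteq> A \<and> card S = n \<and> T \<subseteq> S} = (card A - card T) choose (n - card T)"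
proof -
  have fT: "finite T" using assms finite_subset by blast
  have "bij_betw (\<lambda>S. S - T) {S. S \<subseteq> A \<and> card S = n \<and> T \<subseteq> S}
      {R. R \<subseteq> A - T \<and> card R = n - card T}"
  proof (rule bij_betw_byWitness[where f' = "\<lambda>R. R \<union> T"])
    show "(\<lambda>S. S - T) ` {S. S \<subseteq> A \<and> card S = n \<and> T \<subseteq> S} \<subseteq> {R. R \<subseteq> A - T \<and> card R = n - card T}"
      using fT by (auto simp: card_Diff_subset)
    show "(\<lambda>R. R \<union> T) ` {R. R \<subseteq> A - T \<and> card R = n - card T} \<subseteq> {S. S \<subseteq> A \<and> card S = n \<and> T \<subseteq> S}"
    proof clarsimp
      fix R assume R: "R \<subseteq> A - T" "card R = n - card T"
      have "finite R" using R(1) assms(1) finite_subset by blast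
      then have "card (R \<union> T) = card R + card T"
        using fT R(1) by (intro card_Un_disjoint) auto
      then show "R \<subseteq> A \<and> T \<subseteq> A \<and> card (R \<union> T) = n"
        using R assms by auto
    qed
  qed auto
  then have "card {S. S \<subseteq> A \<and> card S = n \<and> T \<subseteq> S} = card {R. R \<subseteq> A - T \<and> card R = n - card T}"
    by (rule bij_betw_same_card)
  also have "\<dots> = card (A - T) choose (n - card T)"
    using assms by (intro n_subsets) auto
  finally show ?thesis using fT assms by (simp add: card_Diff_subset)
qed

text \<open>The quotient of the two binomials is the product of \<open>(n - i) / (N - i)\<close>
  over \<open>i < k\<close>, and each factor is at most \<open>n / N\<close>. It is the chance that
  a uniform \<open>n\<close>-subset contains a given \<open>k\<close>-set.\<close>

lemma binomial_diff_diff_le: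
  assumes "k \<le> n" "n \<le> N" "0 < N"
  shows "real ((N - k) choose (n - k)) \<le> real (N choose n) * (real n / real N) ^ k"
  using assms(1)
proof (induction k)
  case (Suc k)
  have "Suc (n - Suc k) * (Suc (N - Suc k) choose Suc (n - Suc k))
      = Suc (N - Suc k) * ((N - Suc k) choose (n - Suc k))"
    by (rule Suc_times_binomial)
  then have "(n - k) * ((N - k) choose (n - k)) = (N - k) * ((N - Suc k) choose (n - Suc k))"
    using Suc.prems assms(2) by (simp add: Suc_diff_Suc)
  then have "real (n - k) * real ((N - k) choose (n - k))
      = real (N - k) * real ((N - Suc k) choose (n - Suc k))"
    by (metis of_nat_mult)
  then have "real ((N - Suc k) choose (n - Suc k))
      = real (n - k) / real (N - k) * real ((N - k) choose (n - k))"
    using Suc.prems assms(2) by (simp add: field_simps)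
  also have "\<dots> \<le> real n / real N * real ((N - k) choose (n - k))"
  proof (intro mult_right_mono)
    have "real k * real n \<le> real k * real N" using assms(2) by (intro mult_left_mono) auto
    then show "real (n - k) / real (N - k) \<le> real n / real N"
      using Suc.prems assms by (simp add: field_simps of_nat_diff)
  qed auto
  also have "\<dots> \<le> real n / real N * (real (N choose n) * (real n / real N) ^ k)"
    using Suc by (intro mult_left_mono) auto
  finally show ?case by (simp add: mult_ac)
qed auto

subsection \<open>Likelihood ratios of subgraphs\<close>

definition inner_pairs :: "nat set \<Rightarrow> (nat \<times> nat) set" where
  "inner_pairs S = {(i, j). i \<in> S \<and> j \<in> S \<and> i < j}"

lemma finite_inner_pairs [simp]: "finite S \<Longrightarrow> finite (inner_pairs S)"
  by (rule finite_subset[of _ "S \<times> S"]) (auto simp: inner_pairs_def)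

lemma inner_pairs_Int: "inner_pairs (S \<inter> T) = inner_pairs S \<inter> inner_pairs T"
  by (auto simp: inner_pairs_def)

lemma inner_pairs_mono: "S \<subseteq> T \<Longrightarrow> inner_pairs S \<subseteq> inner_pairs T"
  by (auto simp: inner_pairs_def)

lemma inner_pairs_subset_node_pairs: "S \<subseteq> {1..N} \<Longrightarrow> inner_pairs S \<subseteq> node_pairs N"
  by (auto simp: inner_pairs_def node_pairs_def)

lemma card_inner_pairs:
  assumes "finite S"
  shows "card (inner_pairs S) = card S choose 2"
proof -
  have "bij_betw (\<lambda>(i, j). {i, j}) (inner_pairs S) {B. B \<subseteq> S \<and> card B = 2}"
    unfolding bij_betw_def
  proof
    show "inj_on (\<lambda>(i, j). {i, j}) (inner_pairs S)"
      by (auto simp: inj_on_def inner_pairs_def doubleton_eq_iff)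
    show "(\<lambda>(i, j). {i, j}) ` inner_pairs S = {B. B \<subseteq> S \<and> card B = 2}"
    proof (intro equalityI subsetI)
      fix B assume "B \<in> {B. B \<subseteq> S \<and> card B = 2}"
      then obtain x y where B: "B = {x, y}" "x \<noteq> y" "x \<in> S" "y \<in> S"
        by (auto simp: card_2_iff)
      show "B \<in> (\<lambda>(i, j). {i, j}) ` inner_pairs S"
      proof (cases "x < y")
        case True
        then show ?thesis using B by (intro image_eqI[of _ _ "(x, y)"]) (auto simp: inner_pairs_def)
      next
        case False
        then show ?thesis using B by (intro image_eqI[of _ _ "(y, x)"]) (auto simp: inner_pairs_def)
      qed
    qed (auto simp: inner_pairs_def)
  qed
  then show ?thesis
    using n_subsets[OF assms, of 2] bij_betw_same_card by fastforce
qed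

definition lr :: "real \<Rightarrow> real \<Rightarrow> bool \<Rightarrow> real" where
  "lr p0 p1 b = (if b then p1 / p0 else (1 - p1) / (1 - p0))"

text \<open>The null moment of order \<open>q\<close> of \<open>lr\<close>. As
  \<open>0 powr 0 = 0\<close>, its value for \<open>p1 = 1\<close> and \<open>q = 0\<close> is
  \<open>p0\<close> rather than 1, in agreement with \<open>lr p0 p1 b powr q\<close>.\<close>

definition lr_moment :: "real \<Rightarrow> real \<Rightarrow> real \<Rightarrow> real" where
  "lr_moment p0 p1 q = p0 * (p1 / p0) powr q + (1 - p0) * ((1 - p1) / (1 - p0)) powr q"

lemma lr_moment_nonneg: "0 < p0 \<Longrightarrow> p0 < 1 \<Longrightarrow> 0 \<le> lr_moment p0 p1 q"
  by (simp add: lr_moment_def)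

text \<open>The null model before the edges are assembled into a matrix; here independence is
  literally a product of \<open>pmf\<close>s.\<close>

definition edge_law :: "nat \<Rightarrow> real \<Rightarrow> (nat \<times> nat \<Rightarrow> bool) pmf" where
  "edge_law N p0 = Pi_pmf (node_pairs N) False (\<lambda>_. bernoulli_pmf p0)"

definition subgraph_lr :: "real \<Rightarrow> real \<Rightarrow> nat set \<Rightarrow> (nat \<times> nat \<Rightarrow> bool) \<Rightarrow> real" where
  "subgraph_lr p0 p1 S e = (\<Prod>x\<in>inner_pairs S. lr p0 p1 (e x))"

lemma finite_set_Pi_pmf:
  fixes p :: "'a \<Rightarrow> bool pmf"
  assumes "finite A"
  shows "finite (set_pmf (Pi_pmf A d p))"
  using assms by (auto simp: set_Pi_pmf intro!: finite_PiE_dflt)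

lemma finite_set_edge_law [simp]: "finite (set_pmf (edge_law N p0))"
  by (simp add: edge_law_def finite_set_Pi_pmf)

lemma integrable_edge_law [simp]:
  fixes f :: "_ \<Rightarrow> real"
  shows "integrable (measure_pmf (edge_law N p0)) f"
  by (rule integrable_measure_pmf_finite) simp

locale planted_community =
  fixes N :: nat and p0 p1 :: real
  assumes p0_gt_0: "0 < p0" and p0_lt_p1: "p0 < p1" and p1_le_1: "p1 \<le> 1"
begin

abbreviation E0 :: "((nat \<times> nat \<Rightarrow> bool) \<Rightarrow> real) \<Rightarrow> real" where
  "E0 f \<equiv> measure_pmf.expectation (edge_law N p0) f"

abbreviation L :: "nat set \<Rightarrow> (nat \<times> nat \<Rightarrow> bool) \<Rightarrow> real" where
  "L \<equiv> subgraph_lr p0 p1"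

abbreviation mom :: "real \<Rightarrow> real" where
  "mom \<equiv> lr_moment p0 p1"

lemma E0_mono: "(\<And>e. f e \<le> g e) \<Longrightarrow> E0 f \<le> E0 g"
  by (intro integral_mono) auto

lemma lr_nonneg: "0 \<le> lr p0 p1 b"
  using p0_gt_0 p0_lt_p1 p1_le_1 by (auto simp: lr_def)

lemma L_nonneg: "0 \<le> L S e"
  by (simp add: subgraph_lr_def prod_nonneg lr_nonneg)

lemma L_powr:
  "L S e powr q = (\<Prod>x\<in>inner_pairs S. lr p0 p1 (e x) powr q)"
  by (simp add: subgraph_lr_def prod_powr_distrib)

text \<open>Edges are independent and \<open>lr\<close> has null mean 1, so pairs in
  \<open>A\<close> contribute a factor 1 and each pair in \<open>B\<close> a factor
  \<open>mom q\<close>.\<close>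

lemma E0_prod_lr:
  assumes "A \<subseteq> node_pairs N" "B \<subseteq> node_pairs N" "A \<inter> B = {}"
  shows "E0 (\<lambda>e. (\<Prod>x\<in>A. lr p0 p1 (e x)) * (\<Prod>x\<in>B. lr p0 p1 (e x) powr q)) = mom q ^ card B"
proof -
  \<comment> \<open>Padding with 1 merges both products into one over all node pairs, the form in
    which the product law factorises expectations.\<close>
  define f where "f x b = (if x \<in> A then lr p0 p1 b else 1) * (if x \<in> B then lr p0 p1 b powr q else 1)"
    for x :: "nat \<times> nat" and b
  have f_nonneg: "0 \<le> f x b" for x b using lr_nonneg by (auto simp: f_def)
  have E: "p0 * f x True + (1 - p0) * f x False = (if x \<in> B then mom q else 1)" for x
    using assms(3) p0_gt_0 p0_lt_p1 p1_le_1 by (auto simp: f_def lr_moment_def lr_def)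
  have "(\<Prod>x\<in>A. g x) = (\<Prod>x\<in>node_pairs N. if x \<in> A then g x else 1)"
    "(\<Prod>x\<in>B. g x) = (\<Prod>x\<in>node_pairs N. if x \<in> B then g x else 1)" for g :: "_ \<Rightarrow> real"
    using assms by (simp_all add: prod.inter_restrict[symmetric] Int_absorb1)
  then have "E0 (\<lambda>e. (\<Prod>x\<in>A. lr p0 p1 (e x)) * (\<Prod>x\<in>B. lr p0 p1 (e x) powr q))
      = E0 (\<lambda>e. \<Prod>x\<in>node_pairs N. f x (e x))"
    by (simp add: f_def prod.distrib)
  also have "\<dots> = (\<Prod>x\<in>node_pairs N. measure_pmf.expectation (bernoulli_pmf p0) (f x))"
    unfolding edge_law_def
    by (intro expectation_prod_Pi_pmf) (auto simp: f_nonneg intro: integrable_measure_pmf_finite)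
  also have "\<dots> = (\<Prod>x\<in>node_pairs N. if x \<in> B then mom q else 1)"
    using p0_gt_0 p0_lt_p1 p1_le_1 by (intro prod.cong refl) (simp add: E[symmetric] mult.commute)
  also have "\<dots> = mom q ^ card B"
    using assms by (simp add: prod.inter_restrict[symmetric] Int_absorb1)
  finally show ?thesis .
qed

lemma L_split:
  assumes "T \<subseteq> S" "finite S"
  shows "L S e = (\<Prod>x\<in>inner_pairs S - inner_pairs T. lr p0 p1 (e x)) * L T e"
  unfolding subgraph_lr_def using assms by (intro prod.subset_diff) (auto simp: inner_pairs_mono)

text \<open>Since \<open>L S\<close> is the density of the planted law, this is the moment of order
  \<open>s\<close> of \<open>L T\<close> under that law; pairs outside \<open>T\<close> integrate to
  1.\<close>

lemma E0_L_powr: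
  assumes "T \<subseteq> S" "S \<subseteq> {1..N}" "0 \<le> s"
  shows "E0 (\<lambda>e. L S e * L T e powr s) = mom (1 + s) ^ (card T choose 2)"
proof -
  have fin: "finite S" "finite T"
    using finite_subset[OF assms(2)] finite_subset[OF assms(1)] by auto
  have "L S e * L T e powr s = (\<Prod>x\<in>inner_pairs S - inner_pairs T. lr p0 p1 (e x)) *
      (\<Prod>x\<in>inner_pairs T. lr p0 p1 (e x) powr (1 + s))" for e
  proof -
    have "L T e * L T e powr s = L T e powr (1 + s)"
      using L_nonneg[of T e] by (simp add: powr_add)
    then show ?thesis by (simp only: L_split[OF assms(1) fin(1)] L_powr[symmetric] mult.assoc)
  qed
  then have "E0 (\<lambda>e. L S e * L T e powr s) = mom (1 + s) ^ card (inner_pairs T)"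
    using assms inner_pairs_subset_node_pairs[of S N] inner_pairs_mono[of T S]
    by (simp only:) (intro E0_prod_lr; auto)
  then show ?thesis using card_inner_pairs[OF fin(2)] by simp
qed

lemma E0_L: "S \<subseteq> {1..N} \<Longrightarrow> E0 (L S) = 1"
  using E0_prod_lr[of "inner_pairs S" "{}" 0] inner_pairs_subset_node_pairs[of S N]
  by (simp add: subgraph_lr_def[abs_def])

text \<open>Pairs inside only one of the two communities occur to the first power and integrate to
  1, so only pairs inside the intersection remain. The free exponent serves both the plain and the
  truncated second moment.\<close>

lemma E0_L_L_powr:
  assumes "S1 \<subseteq> {1..N}" "S2 \<subseteq> {1..N}" "0 \<le> s"
  defines "T \<equiv> S1 \<inter> S2"
  shows "E0 (\<lambda>e. (\<Prod>x\<in>inner_pairs S1 - inner_pairs T. lr p0 p1 (e x)) *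
            (\<Prod>x\<in>inner_pairs S2 - inner_pairs T. lr p0 p1 (e x)) * L T e powr s)
         = mom s ^ (card T choose 2)"
proof -
  have fin: "finite S1" "finite S2" "finite T" unfolding T_def using assms finite_subset by blast+
  let ?A = "(inner_pairs S1 - inner_pairs T) \<union> (inner_pairs S2 - inner_pairs T)"
  have "(\<Prod>x\<in>inner_pairs S1 - inner_pairs T. lr p0 p1 (e x)) *
      (\<Prod>x\<in>inner_pairs S2 - inner_pairs T. lr p0 p1 (e x)) = (\<Prod>x\<in>?A. lr p0 p1 (e x))" for e
    using fin by (intro prod.union_disjoint[symmetric]) (auto simp: T_def inner_pairs_Int)
  moreover have "E0 (\<lambda>e. (\<Prod>x\<in>?A. lr p0 p1 (e x)) * (\<Prod>x\<in>inner_pairs T. lr p0 p1 (e x) powr s))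
      = mom s ^ card (inner_pairs T)"
    using assms inner_pairs_subset_node_pairs[of S1 N] inner_pairs_subset_node_pairs[of S2 N]
    by (intro E0_prod_lr) (auto simp: T_def inner_pairs_Int)
  ultimately show ?thesis using card_inner_pairs[OF fin(3)] fin by (simp add: L_powr)
qed

text \<open>Change of measure: by independence the density of the planted law with respect to the
  null law is the product of the edge ratios inside \<open>S\<close>.\<close>

lemma alt_law_expectation:
  fixes f :: "_ \<Rightarrow> real"
  assumes S: "S \<subseteq> {1..N}"
  shows "measure_pmf.expectation (alt_law N p0 p1 S) f
       = E0 (\<lambda>e. L S e * f (adjacency_matrix N e))"
proof -
  let ?q = "\<lambda>(i, j). bernoulli_pmf (if i \<in> S \<and> j \<in> S then p1 else p0)"
  \<comment> \<open>A finite set carrying both laws, whose supports may differ when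
    \<open>p1 = 1\<close>; both expectations become sums over it.\<close>
  let ?D = "PiE_dflt (node_pairs N) False (\<lambda>_. UNIV)"
  have fin: "finite ?D" by (intro finite_PiE_dflt) auto
  have sub: "set_pmf (Pi_pmf (node_pairs N) False q) \<subseteq> ?D" for q :: "_ \<Rightarrow> bool pmf"
    by (auto simp: set_Pi_pmf PiE_dflt_def)
  have point: "pmf (?q x) b = (if x \<in> inner_pairs S then lr p0 p1 b else 1) * pmf (bernoulli_pmf p0) b"
    if "x \<in> node_pairs N" for x b
    using that p0_gt_0 p0_lt_p1 p1_le_1
    by (cases b) (auto simp: inner_pairs_def node_pairs_def lr_def split: prod.splits)
  have pmf: "pmf (Pi_pmf (node_pairs N) False ?q) e = L S e * pmf (edge_law N p0) e" for e
  proof -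
    have "(\<Prod>x\<in>node_pairs N. pmf (?q x) (e x))
      = (\<Prod>x\<in>node_pairs N. if x \<in> inner_pairs S then lr p0 p1 (e x) else 1) *
        (\<Prod>x\<in>node_pairs N. pmf (bernoulli_pmf p0) (e x))"
      unfolding prod.distrib[symmetric] by (intro prod.cong refl point)
    also have "(\<Prod>x\<in>node_pairs N. if x \<in> inner_pairs S then lr p0 p1 (e x) else 1) = L S e"
      using inner_pairs_subset_node_pairs[OF S]
      by (simp add: prod.inter_restrict[symmetric] Int_absorb1 subgraph_lr_def)
    finally have prod: "(\<Prod>x\<in>node_pairs N. pmf (?q x) (e x))
      = L S e * (\<Prod>x\<in>node_pairs N. pmf (bernoulli_pmf p0) (e x))" .
    show ?thesis
      unfolding edge_law_def pmf_Pi[OF finite_node_pairs] prod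
      by (simp only: if_distrib[of "(*) _"] mult_zero_right)
  qed
  have "measure_pmf.expectation (alt_law N p0 p1 S) f
      = measure_pmf.expectation (Pi_pmf (node_pairs N) False ?q) (\<lambda>e. f (adjacency_matrix N e))"
    by (simp add: alt_law_def)
  also have "\<dots> = (\<Sum>e\<in>?D. f (adjacency_matrix N e) * pmf (Pi_pmf (node_pairs N) False ?q) e)"
    using sub fin by (intro integral_measure_pmf_real) blast+
  also have "\<dots> = (\<Sum>e\<in>?D. (L S e * f (adjacency_matrix N e)) * pmf (edge_law N p0) e)"
    by (simp add: pmf mult_ac)
  also have "\<dots> = E0 (\<lambda>e. L S e * f (adjacency_matrix N e))"
    using sub fin unfolding edge_law_def by (intro integral_measure_pmf_real[symmetric]) blast+
  finally show ?thesis .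
qed

end

subsection \<open>The truncated second moment\<close>

text \<open>
  The exponents \<open>s k\<close> are Markov exponents: \<open>tail_weight k\<close> bounds the probability under
  \<open>P\<^sub>T\<close>, \<open>card T = k\<close>, that the likelihood ratio of \<open>T\<close> exceeds its truncation level \<open>(N / n) ^ k\<close>.
\<close>

locale truncated_community = planted_community +
  fixes n :: nat and thr :: real and s :: "nat \<Rightarrow> real"
  assumes n_pos: "0 < n" and n_le_N: "n \<le> N" and thr_pos: "0 < thr"
    and s_nonneg: "\<And>k. 0 \<le> s k" and s_le_1: "\<And>k. s k \<le> 1"
begin

abbreviation level :: "nat \<Rightarrow> real" where
  "level k \<equiv> (real N / real n) ^ k"

definition tail_weight :: "nat \<Rightarrow> real" where
  "tail_weight k = level k powr - s k * mom (1 + s k) ^ (k choose 2)"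

text \<open>A union bound over all subsets of one community of size at least
  \<open>thr\<close>.\<close>

definition tail_mass :: real where
  "tail_mass = (\<Sum>k\<in>{k. k \<le> n \<and> thr \<le> real k}. real (n choose k) * tail_weight k)"

definition typical :: "nat set \<Rightarrow> (nat \<times> nat \<Rightarrow> bool) \<Rightarrow> bool" where
  "typical S e \<longleftrightarrow> (\<forall>T\<subseteq>S. thr \<le> real (card T) \<longrightarrow> L T e \<le> level (card T))"

definition trunc_lr :: "nat set \<Rightarrow> (nat \<times> nat \<Rightarrow> bool) \<Rightarrow> real" where
  "trunc_lr S e = (if typical S e then L S e else 0)"

definition communities :: "nat set set" where
  "communities = {S. S \<subseteq> {1..N} \<and> card S = n}"

lemma level_pos: "0 < level k"
  using n_pos n_le_N by simp

lemma mom_nonneg: "0 \<le> mom q"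
  using p0_gt_0 p0_lt_p1 p1_le_1 by (intro lr_moment_nonneg) auto

lemma tail_weight_nonneg: "0 \<le> tail_weight k"
  by (simp add: tail_weight_def mom_nonneg)

lemma finite_communities [simp]: "finite communities"
  by (rule finite_subset[of _ "Pow {1..N}"]) (auto simp: communities_def)

lemma card_communities: "card communities = N choose n"
  unfolding communities_def using n_subsets[of "{1..N}" n] by simp

lemma trunc_lr_nonneg: "0 \<le> trunc_lr S e"
  by (simp add: trunc_lr_def L_nonneg)

lemma trunc_lr_le: "trunc_lr S e \<le> L S e"
  by (simp add: trunc_lr_def L_nonneg)

lemma sum_tail_eq:
  "(\<Sum>k\<le>n. real (n choose k) * (if thr \<le> real k then g k else 0))
     = (\<Sum>k\<in>{k. k \<le> n \<and> thr \<le> real k}. real (n choose k) * g k)"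
proof -
  have "{k. k \<le> n \<and> thr \<le> real k} = {k \<in> {..n}. thr \<le> real k}" by auto
  then have "(\<Sum>k\<in>{k. k \<le> n \<and> thr \<le> real k}. real (n choose k) * g k)
      = (\<Sum>k\<le>n. if thr \<le> real k then real (n choose k) * g k else 0)"
    by (simp only: sum.inter_filter[OF finite_atMost])
  then show ?thesis by (auto intro!: sum.cong)
qed

text \<open>Markov's inequality and the union bound in pointwise form: if \<open>S\<close> is not
  typical, some \<open>T\<close> exceeds its level, so
  \<open>(L T e / level (card T)) powr s (card T)\<close> is at least 1 and the summand of this
  \<open>T\<close> alone absorbs \<open>L S e\<close>.\<close>

lemma trunc_lr_ge:
  assumes "finite S"
  shows "L S e - (\<Sum>T\<in>Pow S. if thr \<le> real (card T)
            then L S e * L T e powr s (card T) * level (card T) powr - s (card T) else 0)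
         \<le> trunc_lr S e" (is "_ - sum ?g _ \<le> _")
proof (cases "typical S e")
  case True
  have "0 \<le> sum ?g (Pow S)" by (intro sum_nonneg) (auto simp: L_nonneg)
  then show ?thesis using True by (simp add: trunc_lr_def)
next
  case False
  then obtain T where T: "T \<subseteq> S" "thr \<le> real (card T)" "level (card T) < L T e"
    by (auto simp: typical_def not_le)
  let ?k = "card T"
  have "1 = level ?k powr s ?k * level ?k powr - s ?k"
    using n_pos n_le_N by (simp only: powr_add[symmetric]) simp
  also have "\<dots> \<le> L T e powr s ?k * level ?k powr - s ?k"
    using T s_nonneg level_pos[of ?k] by (intro mult_right_mono powr_mono2) auto
  finally have "L S e * 1 \<le> L S e * (L T e powr s ?k * level ?k powr - s ?k)"
    by (intro mult_left_mono L_nonneg)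
  also have "\<dots> = ?g T" using T by simp
  also have "\<dots> \<le> sum ?g (Pow S)"
    using T assms by (intro member_le_sum) (auto simp: L_nonneg)
  finally show ?thesis using False by (simp add: trunc_lr_def)
qed

lemma E0_trunc_lr_ge:
  assumes "S \<in> communities"
  shows "1 - tail_mass \<le> E0 (trunc_lr S)"
proof -
  have S: "S \<subseteq> {1..N}" "card S = n" "finite S"
    using assms finite_subset by (auto simp: communities_def)
  let ?g = "\<lambda>T e. if thr \<le> real (card T)
            then L S e * L T e powr s (card T) * level (card T) powr - s (card T) else 0"
  have g: "E0 (?g T) = (if thr \<le> real (card T) then tail_weight (card T) else 0)"
    if "T \<in> Pow S" for T
    using that E0_L_powr[of T S "s (card T)"] S s_nonneg by (simp add: tail_weight_def)
  have "(\<Sum>T\<in>Pow S. E0 (?g T)) = (\<Sum>T\<in>Pow S. if thr \<le> real (card T) then tail_weight (card T) else 0)"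
    using g by (intro sum.cong) auto
  also have "\<dots> = tail_mass"
    unfolding tail_mass_def
    using sum_Pow_card[OF S(3), of "\<lambda>k. if thr \<le> real k then tail_weight k else 0"] S(2)
      sum_tail_eq[of tail_weight]
    by simp
  finally have "E0 (\<lambda>e. L S e - (\<Sum>T\<in>Pow S. ?g T e)) = 1 - tail_mass"
    using E0_L[OF S(1)] by simp
  moreover have "E0 (\<lambda>e. L S e - (\<Sum>T\<in>Pow S. ?g T e)) \<le> E0 (trunc_lr S)"
    by (intro E0_mono trunc_lr_ge S)
  ultimately show ?thesis by simp
qed

definition overlap_bound :: "nat \<Rightarrow> real" where
  "overlap_bound k = (if thr \<le> real k then level k * tail_weight k else mom 2 ^ (k choose 2))"

text \<open>Write the square as \<open>x powr (1 - a) * x powr (1 + a)\<close> and bound only the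
  first factor, whose exponent is nonnegative.\<close>

lemma square_le_powr:
  fixes x z :: real
  assumes "0 \<le> x" "x \<le> z" "0 < z" "a \<le> 1"
  shows "x * x \<le> z powr (1 - a) * x powr (1 + a)"
proof (cases "x = 0")
  case False
  then have "x * x = x powr (1 - a) * x powr (1 + a)"
    using assms by (simp add: powr_add[symmetric] power2_eq_square)
  also have "\<dots> \<le> z powr (1 - a) * x powr (1 + a)"
    using assms by (intro mult_right_mono powr_mono2) auto
  finally show ?thesis .
qed auto

text \<open>Only pairs inside the overlap \<open>T\<close> enter squared. For a large overlap,
  typicality of \<open>S1\<close> bounds \<open>L T\<close> because \<open>T \<subseteq> S1\<close>,
  which lowers the exponent from 2 to \<open>1 + s (card T)\<close>; for a small overlap the
  truncation is dropped and the plain second moment is used.\<close>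

lemma E0_trunc_lr_mult_le:
  assumes "S1 \<in> communities" "S2 \<in> communities"
  shows "E0 (\<lambda>e. trunc_lr S1 e * trunc_lr S2 e) \<le> overlap_bound (card (S1 \<inter> S2))"
proof -
  define T where "T = S1 \<inter> S2"
  let ?k = "card T"
  have S: "S1 \<subseteq> {1..N}" "finite S1" "S2 \<subseteq> {1..N}" "finite S2"
    using assms finite_subset by (auto simp: communities_def)
  define P where "P e = (\<Prod>x\<in>inner_pairs S1 - inner_pairs T. lr p0 p1 (e x)) *
      (\<Prod>x\<in>inner_pairs S2 - inner_pairs T. lr p0 p1 (e x))" for e
  have P_nonneg: "0 \<le> P e" for e
    unfolding P_def by (intro mult_nonneg_nonneg prod_nonneg ballI lr_nonneg)
  have LL: "L S1 e * L S2 e = P e * (L T e * L T e)" for e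
    using L_split[of T S1 e] L_split[of T S2 e] S by (simp add: P_def T_def)
  have EP: "E0 (\<lambda>e. P e * L T e powr q) = mom q ^ (?k choose 2)" if "0 \<le> q" for q
    using E0_L_L_powr[OF S(1) S(3) that] by (simp add: P_def T_def)
  show ?thesis
  proof (cases "thr \<le> real ?k")
    case True
    let ?s = "s ?k"
    have "trunc_lr S1 e * trunc_lr S2 e \<le> level ?k powr (1 - ?s) * (P e * L T e powr (1 + ?s))" for e
    proof (cases "typical S1 e")
      case typical: True
      then have "L T e \<le> level ?k" using True by (auto simp: typical_def T_def)
      then have "L T e * L T e \<le> level ?k powr (1 - ?s) * L T e powr (1 + ?s)"
        by (intro square_le_powr L_nonneg level_pos s_le_1)
      then have "P e * (L T e * L T e) \<le> P e * (level ?k powr (1 - ?s) * L T e powr (1 + ?s))"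
        by (intro mult_left_mono P_nonneg)
      moreover have "trunc_lr S1 e * trunc_lr S2 e \<le> L S1 e * L S2 e"
        by (intro mult_mono trunc_lr_le trunc_lr_nonneg L_nonneg)
      ultimately show ?thesis by (simp add: LL mult_ac)
    next
      case False
      then show ?thesis by (simp add: trunc_lr_def P_nonneg)
    qed
    then have "E0 (\<lambda>e. trunc_lr S1 e * trunc_lr S2 e)
        \<le> E0 (\<lambda>e. level ?k powr (1 - ?s) * (P e * L T e powr (1 + ?s)))"
      by (rule E0_mono)
    also have "\<dots> = level ?k powr (1 - ?s) * mom (1 + ?s) ^ (?k choose 2)"
      using EP[of "1 + ?s"] s_nonneg[of ?k] by simp
    also have "\<dots> = level ?k * tail_weight ?k"
      using level_pos[of ?k] by (simp add: tail_weight_def powr_diff powr_minus divide_inverse)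
    finally show ?thesis using True by (simp add: overlap_bound_def T_def)
  next
    case False
    have "trunc_lr S1 e * trunc_lr S2 e \<le> P e * L T e powr 2" for e
    proof -
      have "trunc_lr S1 e * trunc_lr S2 e \<le> L S1 e * L S2 e"
        by (intro mult_mono trunc_lr_le trunc_lr_nonneg L_nonneg)
      then show ?thesis using L_nonneg[of T e] by (simp add: LL power2_eq_square)
    qed
    then have "E0 (\<lambda>e. trunc_lr S1 e * trunc_lr S2 e) \<le> E0 (\<lambda>e. P e * L T e powr 2)"
      by (rule E0_mono)
    then show ?thesis using EP[of 2] False by (simp add: overlap_bound_def T_def)
  qed
qed

text \<open>The distribution of the overlap size is avoided: the term for
  \<open>S1 \<inter> S2\<close> is bounded by the sum over all \<open>T \<subseteq> S1\<close> with
  \<open>T \<subseteq> S2\<close>. After the sums are swapped, a fixed \<open>T\<close> lies in at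
  most a fraction \<open>(n / N) ^ card T\<close> of the communities, which cancels the factor
  \<open>level (card T)\<close>.\<close>

lemma sum_overlap_bound_le:
  assumes S1: "S1 \<in> communities"
    and small: "\<And>k. k \<le> n \<Longrightarrow> real k < thr \<Longrightarrow> mom 2 ^ (k choose 2) \<le> 1 + \<delta>" and \<delta>: "0 \<le> \<delta>"
  shows "(\<Sum>S2\<in>communities. overlap_bound (card (S1 \<inter> S2)))
           \<le> real (card communities) * (1 + \<delta> + tail_mass)"
proof -
  have S: "S1 \<subseteq> {1..N}" "card S1 = n" "finite S1"
    using S1 finite_subset by (auto simp: communities_def)
  let ?w = "\<lambda>k. if thr \<le> real k then level k * tail_weight k else 0"
  have w_nonneg: "0 \<le> ?w k" for k using tail_weight_nonneg level_pos[of k] by simp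
  have pt: "overlap_bound (card (S1 \<inter> S2))
      \<le> (1 + \<delta>) + (\<Sum>T\<in>Pow S1. if T \<subseteq> S2 then ?w (card T) else 0)" for S2
  proof -
    have "overlap_bound (card (S1 \<inter> S2)) \<le> (1 + \<delta>) + ?w (card (S1 \<inter> S2))"
      using small[of "card (S1 \<inter> S2)"] S \<delta> card_mono[of S1 "S1 \<inter> S2"]
      by (auto simp: overlap_bound_def)
    moreover have "(if S1 \<inter> S2 \<subseteq> S2 then ?w (card (S1 \<inter> S2)) else 0)
        \<le> (\<Sum>T\<in>Pow S1. if T \<subseteq> S2 then ?w (card T) else 0)"
      using S w_nonneg by (intro member_le_sum) auto
    ultimately show ?thesis by simp
  qed
  have count: "(\<Sum>S2\<in>communities. if T \<subseteq> S2 then ?w (card T) else 0)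
      \<le> real (card communities) * (if thr \<le> real (card T) then tail_weight (card T) else 0)"
    if T: "T \<in> Pow S1" for T
  proof -
    let ?k = "card T"
    have k: "?k \<le> n" using T S card_mono[of S1 T] by auto
    have "(\<Sum>S2\<in>communities. if T \<subseteq> S2 then ?w ?k else 0)
        = real (card {S2 \<in> communities. T \<subseteq> S2}) * ?w ?k"
      by (subst sum.inter_filter[symmetric]) auto
    also have "{S2 \<in> communities. T \<subseteq> S2} = {S. S \<subseteq> {1..N} \<and> card S = n \<and> T \<subseteq> S}"
      by (auto simp: communities_def)
    also have "card \<dots> = (N - ?k) choose (n - ?k)"
      using card_supersets[of "{1..N}" T n] T S k by auto
    also have "real \<dots> * ?w ?k \<le> real (N choose n) * (real n / real N) ^ ?k * ?w ?k"
      using k n_le_N n_pos by (intro mult_right_mono w_nonneg binomial_diff_diff_le) auto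
    also have "\<dots> = real (card communities) * (if thr \<le> real ?k then tail_weight ?k else 0)"
      using n_le_N n_pos by (simp add: card_communities power_divide)
    finally show ?thesis .
  qed
  have "(\<Sum>S2\<in>communities. overlap_bound (card (S1 \<inter> S2)))
      \<le> (\<Sum>S2\<in>communities. (1 + \<delta>) + (\<Sum>T\<in>Pow S1. if T \<subseteq> S2 then ?w (card T) else 0))"
    by (intro sum_mono pt)
  also have "\<dots> = real (card communities) * (1 + \<delta>)
      + (\<Sum>S2\<in>communities. \<Sum>T\<in>Pow S1. if T \<subseteq> S2 then ?w (card T) else 0)"
    by (simp add: sum.distrib distrib_left)
  also have "(\<Sum>S2\<in>communities. \<Sum>T\<in>Pow S1. if T \<subseteq> S2 then ?w (card T) else 0)
      = (\<Sum>T\<in>Pow S1. \<Sum>S2\<in>communities. if T \<subseteq> S2 then ?w (card T) else 0)"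
    by (rule sum.swap)
  also have "\<dots> \<le> (\<Sum>T\<in>Pow S1. real (card communities) *
      (if thr \<le> real (card T) then tail_weight (card T) else 0))"
    by (intro sum_mono count)
  also have "\<dots> = real (card communities) * tail_mass"
    unfolding sum_distrib_left[symmetric] tail_mass_def
    using sum_Pow_card[OF S(3), of "\<lambda>k. if thr \<le> real k then tail_weight k else 0"] S(2)
      sum_tail_eq[of tail_weight]
    by simp
  finally show ?thesis by (simp add: distrib_left)
qed

text \<open>A maximum is at least an average, so the risk is at least the null mean of
  \<open>(1 - \<phi>) + Y * \<phi>\<close>, where \<open>\<phi>\<close> indicates acceptance of the
  null and \<open>Y\<close> averages the truncated ratios. This loses at most the positive part of
  \<open>1 - Y\<close>, which the first two moments of \<open>Y\<close> control. The free parameter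
  \<open>c\<close> replaces a square root from Cauchy-Schwarz.\<close>

lemma risk_ge:
  assumes T: "T \<in> tests N" and c: "0 < c"
    and small: "\<And>k. k \<le> n \<Longrightarrow> real k < thr \<Longrightarrow> mom 2 ^ (k choose 2) \<le> 1 + \<delta>" and \<delta>: "0 \<le> \<delta>"
  shows "1 - c - (\<delta> + 3 * tail_mass) / (4 * c) \<le> risk N n p0 p1 T"
proof -
  define M where "M = real (card communities)"
  have M: "0 < M" using n_le_N by (simp add: M_def card_communities)
  define Y where "Y e = (\<Sum>S\<in>communities. trunc_lr S e) / M" for e
  define \<phi> where "\<phi> e = (of_bool (T (adjacency_matrix N e) = 0) :: real)" for e
  have Y_nonneg: "0 \<le> Y e" for e
    using M unfolding Y_def by (intro divide_nonneg_pos sum_nonneg trunc_lr_nonneg)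

  have "M * (1 - tail_mass) = (\<Sum>S\<in>communities. 1 - tail_mass)" by (simp add: M_def)
  also have "\<dots> \<le> (\<Sum>S\<in>communities. E0 (trunc_lr S))" by (intro sum_mono E0_trunc_lr_ge)
  finally have EY: "1 - tail_mass \<le> E0 Y"
    using M by (simp add: Y_def[abs_def] field_simps)

  have "E0 (\<lambda>e. \<Sum>S1\<in>communities. \<Sum>S2\<in>communities. trunc_lr S1 e * trunc_lr S2 e)
      = (\<Sum>S1\<in>communities. \<Sum>S2\<in>communities. E0 (\<lambda>e. trunc_lr S1 e * trunc_lr S2 e))"
    by simp
  also have "\<dots> \<le> (\<Sum>S1\<in>communities. \<Sum>S2\<in>communities. overlap_bound (card (S1 \<inter> S2)))"
    by (intro sum_mono E0_trunc_lr_mult_le)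
  also have "\<dots> \<le> (\<Sum>S1\<in>communities. M * (1 + \<delta> + tail_mass))"
    unfolding M_def by (intro sum_mono sum_overlap_bound_le small \<delta>)
  also have "\<dots> = M\<^sup>2 * (1 + \<delta> + tail_mass)" by (simp add: M_def power2_eq_square)
  finally have "E0 (\<lambda>e. \<Sum>S1\<in>communities. \<Sum>S2\<in>communities. trunc_lr S1 e * trunc_lr S2 e)
      / M\<^sup>2 \<le> 1 + \<delta> + tail_mass"
    using M by (simp add: pos_divide_le_eq mult.commute)
  moreover have "(Y e)\<^sup>2 = (\<Sum>S1\<in>communities. \<Sum>S2\<in>communities. trunc_lr S1 e * trunc_lr S2 e) / M\<^sup>2" for e
    by (simp add: Y_def power_divide power2_eq_square sum_product)
  ultimately have EY2: "E0 (\<lambda>e. (Y e)\<^sup>2) \<le> 1 + \<delta> + tail_mass" by simp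

  have null: "measure_pmf.prob (null_law N p0) {W. T W = 1} = E0 (\<lambda>e. 1 - \<phi> e)"
  proof -
    \<comment> \<open>Tests are constrained only on adjacency matrices, and
      \<open>adjacency_matrix N e\<close> is always one.\<close>
    have T01: "T (adjacency_matrix N e) = 0 \<or> T (adjacency_matrix N e) = 1" for e
      using T adjacency_matrix_in[of N e] by (auto simp: tests_def)
    have "indicator {W. T W = 1} (adjacency_matrix N e) = 1 - \<phi> e" for e
      using T01[of e] by (cases "T (adjacency_matrix N e) = 0") (auto simp: \<phi>_def indicator_def)
    then have "E0 (\<lambda>e. indicator {W. T W = 1} (adjacency_matrix N e)) = E0 (\<lambda>e. 1 - \<phi> e)"
      by presburger
    moreover have "measure_pmf.expectation (null_law N p0) (indicator {W. T W = 1} :: _ \<Rightarrow> real)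
        = E0 (\<lambda>e. indicator {W. T W = 1} (adjacency_matrix N e))"
      unfolding null_law_def edge_law_def by (rule integral_map_pmf)
    ultimately show ?thesis by simp
  qed
  have alt: "measure_pmf.prob (alt_law N p0 p1 S) {W. T W = 0} = E0 (\<lambda>e. L S e * \<phi> e)"
    if "S \<in> communities" for S
  proof -
    have "measure_pmf.prob (alt_law N p0 p1 S) {W. T W = 0}
        = measure_pmf.expectation (alt_law N p0 p1 S) (indicator {W. T W = 0})"
      by simp
    also have "\<dots> = E0 (\<lambda>e. L S e * indicator {W. T W = 0} (adjacency_matrix N e))"
      using that by (intro alt_law_expectation) (auto simp: communities_def)
    finally show ?thesis by (simp add: \<phi>_def indicator_def)
  qed
  let ?F = "\<lambda>S. measure_pmf.prob (alt_law N p0 p1 S) {W. T W = 0}"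
  have max: "(\<Sum>S\<in>communities. E0 (\<lambda>e. L S e * \<phi> e)) \<le> M * (MAX S\<in>communities. ?F S)"
  proof -
    have "(\<Sum>S\<in>communities. E0 (\<lambda>e. L S e * \<phi> e)) = (\<Sum>S\<in>communities. ?F S)"
      by (intro sum.cong) (auto simp: alt)
    also have "\<dots> \<le> (\<Sum>S\<in>communities. MAX S\<in>communities. ?F S)"
      by (intro sum_mono Max_ge) auto
    finally show ?thesis by (simp add: M_def)
  qed
  have "M * E0 (\<lambda>e. Y e * \<phi> e) = (\<Sum>S\<in>communities. E0 (\<lambda>e. trunc_lr S e * \<phi> e))"
    using M by (simp add: Y_def sum_distrib_right)
  also have "\<dots> \<le> (\<Sum>S\<in>communities. E0 (\<lambda>e. L S e * \<phi> e))"
    by (intro sum_mono E0_mono mult_right_mono trunc_lr_le) (auto simp: \<phi>_def)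
  also note max
  finally have alt_ge: "E0 (\<lambda>e. Y e * \<phi> e) \<le> (MAX S\<in>communities. ?F S)"
    using M by simp

  have "1 - c - (1 - 2 * Y e + (Y e)\<^sup>2) / (4 * c) \<le> (1 - \<phi> e) + Y e * \<phi> e" for e
  proof -
    \<comment> \<open>Expanding this square and dividing by \<open>4 * c\<close> bounds
      \<open>1 - Y e\<close> by \<open>c + (1 - Y e)^2 / (4 * c)\<close>.\<close>
    have "0 \<le> (1 - Y e - 2 * c)\<^sup>2" by simp
    then have "1 - Y e \<le> c + (1 - 2 * Y e + (Y e)\<^sup>2) / (4 * c)"
      using c by (simp add: field_simps power2_eq_square)
    moreover have "0 \<le> (1 - Y e)\<^sup>2 / (4 * c)" using c by simp
    then have "0 \<le> (1 - 2 * Y e + (Y e)\<^sup>2) / (4 * c)" by (simp add: power2_diff algebra_simps)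
    ultimately show ?thesis using c by (auto simp: \<phi>_def)
  qed
  then have "E0 (\<lambda>e. 1 - c - (1 - 2 * Y e + (Y e)\<^sup>2) / (4 * c)) \<le> E0 (\<lambda>e. (1 - \<phi> e) + Y e * \<phi> e)"
    by (rule E0_mono)
  then have "1 - c - (1 - 2 * E0 Y + E0 (\<lambda>e. (Y e)\<^sup>2)) / (4 * c) \<le> E0 (\<lambda>e. 1 - \<phi> e) + E0 (\<lambda>e. Y e * \<phi> e)"
    by (simp add: integral_diff integral_add)
  \<comment> \<open>With \<open>t = tail_mass\<close>, the moment bounds add up to
    \<open>1 - 2 * (1 - t) + (1 + \<delta> + t) = \<delta> + 3 * t\<close>.\<close>
  moreover have "(1 - 2 * E0 Y + E0 (\<lambda>e. (Y e)\<^sup>2)) / (4 * c) \<le> (\<delta> + 3 * tail_mass) / (4 * c)"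
    using c EY EY2 by (intro divide_right_mono) auto
  ultimately show ?thesis
    using alt_ge null unfolding risk_def communities_def by linarith
qed

end

subsection \<open>Moments of the likelihood ratio of an edge\<close>

lemma ln_ge_ratio:
  fixes x :: real
  assumes "1 \<le> x"
  shows "2 * (x - 1) / (x + 1) \<le> ln x"
proof -
  let ?f = "\<lambda>x::real. ln x - 2 * (x - 1) / (x + 1)"
  have "?f 1 \<le> ?f x"
  proof (rule DERIV_nonneg_imp_nondecreasing[OF assms])
    fix y :: real assume y: "1 \<le> y"
    have "(?f has_real_derivative (1 / y - 4 / (y + 1)\<^sup>2)) (at y)"
      using y by (auto intro!: derivative_eq_intros simp: field_simps power2_eq_square)
    moreover have "4 * y \<le> (y + 1)\<^sup>2"
      using zero_le_power2[of "y - 1"] by (simp add: power2_eq_square algebra_simps)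
    then have "0 \<le> 1 / y - 4 / (y + 1)\<^sup>2" using y by (simp add: field_simps)
    ultimately show "\<exists>d. (?f has_real_derivative d) (at y) \<and> 0 \<le> d" by blast
  qed
  then show ?thesis by simp
qed

lemma ln_ge_one_minus_inverse:
  fixes x :: real
  assumes "0 < x"
  shows "1 - 1 / x \<le> ln x"
  using ln_le_minus_one[of "1 / x"] assms by (simp add: ln_div)

text \<open>For \<open>w = sqrt t\<close> one has
  \<open>\<bar>w * ln w\<bar> \<le> 1 - w \<le> 1 - t\<close>, and the factor 4 comes from
  \<open>ln t = 2 * ln w\<close>. The bound stays useful as \<open>t\<close> tends to 0, where
  \<open>ln t\<close> is unbounded.\<close>

lemma mult_ln_squared_le:
  fixes t :: real
  assumes "0 < t" "t \<le> 1"
  shows "t * (ln t)\<^sup>2 \<le> 4 * (1 - t)\<^sup>2"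
proof -
  define w where "w = sqrt t"
  have w: "0 < w" "w \<le> 1" "t = w\<^sup>2" using assms by (simp_all add: w_def)
  have "w * ln w \<le> 0" using w by (simp add: mult_nonneg_nonpos)
  moreover have "w * (1 - 1 / w) \<le> w * ln w"
    using w by (intro mult_left_mono ln_ge_one_minus_inverse) auto
  ultimately have "\<bar>w * ln w\<bar> \<le> 1 - w" using w by (simp add: algebra_simps)
  moreover have "w\<^sup>2 \<le> w" using w by (simp add: power2_eq_square mult_left_le)
  ultimately have "\<bar>w * ln w\<bar> \<le> \<bar>1 - t\<bar>" using w by linarith
  then have "(w * ln w)\<^sup>2 \<le> (1 - t)\<^sup>2" by (simp only: abs_le_square_iff)
  moreover have "ln t = 2 * ln w" using w by (simp add: ln_realpow)
  ultimately show ?thesis using w by (simp add: power_mult_distrib)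
qed

lemma exp_le_quadratic_nonneg:
  fixes y :: real
  assumes "0 \<le> y"
  shows "exp y \<le> 1 + y + y\<^sup>2 * exp y / 2"
proof -
  obtain t where t: "\<bar>t\<bar> \<le> \<bar>y\<bar>" "exp y = (\<Sum>m<2. y ^ m / fact m) + exp t / fact 2 * y ^ 2"
    using Maclaurin_exp_le[of y 2] by blast
  have "exp t \<le> exp y" using t(1) assms by (simp only: exp_le_cancel_iff)
  then have "exp t * y\<^sup>2 \<le> exp y * y\<^sup>2" by (intro mult_right_mono) auto
  then show ?thesis using t(2) by (simp add: numeral_2_eq_2 mult.commute)
qed

text \<open>Multiply by \<open>1 - y\<close>: the left side becomes at most 1 because
  \<open>1 - y \<le> exp (- y)\<close>, and the right side becomes \<open>1 - y^3\<close>, which is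
  at least 1.\<close>

lemma exp_le_quadratic_nonpos:
  fixes y :: real
  assumes "y \<le> 0"
  shows "exp y \<le> 1 + y + y\<^sup>2"
proof -
  have y: "0 \<le> y * y" "y * y * y \<le> 0" using assms by (simp_all add: mult_nonneg_nonpos)
  have "exp y * (1 - y) \<le> exp y * exp (- y)"
    using exp_ge_add_one_self[of "- y"] by (intro mult_left_mono) auto
  also have "\<dots> = 1" by (simp add: exp_minus)
  also have "1 \<le> (1 + y + y\<^sup>2) * (1 - y)"
    using y by (simp add: algebra_simps power2_eq_square)
  finally show ?thesis using assms by (simp add: mult_le_cancel_right)
qed

text \<open>This is the bound \<open>(exp 1 * n / k) ^ k\<close>, obtained from
  \<open>k ^ k / fact k \<le> exp k\<close>, a single term of the exponential series.\<close>

lemma binomial_le_exp: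
  assumes "1 \<le> k" "k \<le> n"
  shows "real (n choose k) \<le> exp (real k * (1 + ln (real n / real k)))"
proof -
  have "(real k ^ k) / fact k \<le> exp (real k)"
  proof -
    have "(\<Sum>i\<in>{k}. real k ^ i /\<^sub>R fact i) \<le> (\<Sum>i. real k ^ i /\<^sub>R fact i)"
      by (intro sum_le_suminf summable_exp_generic) auto
    then show ?thesis by (simp add: exp_def divide_inverse mult.commute)
  qed
  then have k: "real k ^ k \<le> exp (real k) * fact k" by (simp add: field_simps)
  have "real (n choose k) * real k ^ k \<le> real (n choose k) * (exp (real k) * fact k)"
    using k by (intro mult_left_mono) auto
  also have "\<dots> = exp (real k) * (real ((n choose k) * fact k))" by simp
  also have "\<dots> \<le> exp (real k) * real (n ^ k)"
    using binomial_fact_pow[of n k] by (intro mult_left_mono of_nat_mono) auto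
  finally have "real (n choose k) \<le> exp (real k) * (real n / real k) ^ k"
    using assms by (simp add: field_simps power_divide)
  also have "(real n / real k) ^ k = exp (real k * ln (real n / real k))"
    using assms by (simp add: exp_of_nat_mult)
  finally show ?thesis by (simp add: exp_add distrib_left)
qed

context planted_community
begin

abbreviation h :: real where "h \<equiv> bernoulli_entropy p0 p1"
abbreviation l :: real where "l \<equiv> ln (p1 / p0)"

lemma l_pos: "0 < l"
  using p0_gt_0 p0_lt_p1 by simp

lemma diff_le_p1_l: "p1 - p0 \<le> p1 * l"
  using mult_left_mono[OF ln_ge_one_minus_inverse[of "p1 / p0"], of p1] p0_gt_0 p0_lt_p1
  by (simp add: algebra_simps)

text \<open>The second entropy term is at least \<open>- (p1 - p0)\<close>, and
  \<open>p1 - p0 \<le> (p1 + p0) * l / 2\<close> by \<open>ln_ge_ratio\<close>; subtracting from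
  \<open>p1 * l\<close> leaves the claim. It lets second-order errors be measured in multiples of
  \<open>h\<close>.\<close>

lemma entropy_ge: "(p1 - p0) * l / 2 \<le> h"
proof -
  have "- (p1 - p0) \<le> (1 - p1) * ln ((1 - p1) / (1 - p0))"
  proof (cases "p1 = 1")
    case False
    then have "(1 - p1) * (1 - 1 / ((1 - p1) / (1 - p0))) \<le> (1 - p1) * ln ((1 - p1) / (1 - p0))"
      using p0_gt_0 p0_lt_p1 p1_le_1 by (intro mult_left_mono ln_ge_one_minus_inverse) auto
    moreover have "(1 - p1) * (1 - 1 / ((1 - p1) / (1 - p0))) = - (p1 - p0)"
      using False by (simp add: field_simps)
    ultimately show ?thesis by simp
  qed (use p0_lt_p1 in simp)
  then have "p1 * l - (p1 - p0) \<le> h" by (simp add: bernoulli_entropy_def)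
  moreover have "2 * (p1 - p0) \<le> (p1 + p0) * l"
  proof -
    have "(p1 + p0) * (2 * (p1 / p0 - 1) / (p1 / p0 + 1)) \<le> (p1 + p0) * l"
      using p0_gt_0 p0_lt_p1 by (intro mult_left_mono ln_ge_ratio) auto
    moreover have "(p1 + p0) * (2 * (p1 / p0 - 1) / (p1 / p0 + 1)) = 2 * (p1 - p0)"
      using p0_gt_0 p0_lt_p1 by (simp add: divide_simps)
    ultimately show ?thesis by simp
  qed
  ultimately show ?thesis by (simp add: algebra_simps)
qed

lemma h_nonneg: "0 \<le> h"
  using entropy_ge l_pos p0_lt_p1
  by (smt (verit) divide_nonneg_nonneg mult_nonneg_nonneg)

text \<open>To first order in \<open>s\<close> the moment is \<open>1 + s * h\<close>. The
  second-order terms of a present and of an absent edge are each bounded by a multiple of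
  \<open>h\<close>, so the error is relative to \<open>h\<close>; the bound \<open>c\<close> keeps
  \<open>1 - p0\<close> away from 0.\<close>

lemma lr_moment_le:
  assumes "0 \<le> s" "p0 \<le> c" "c < 1"
  shows "mom (1 + s) \<le> 1 + s * h * (1 + (1 + 8 / (1 - c)) * s * (1 + l) * exp (s * l))"
proof -
  define t where "t = (1 - p1) / (1 - p0)"
  have p: "0 < p0" "p0 < p1" "p1 \<le> 1" "p0 < 1" using p0_gt_0 p0_lt_p1 p1_le_1 by auto
  have mom: "mom (1 + s) = p1 * exp (s * l) + (1 - p1) * t powr s"
  proof -
    have "0 \<le> t" using p by (simp add: t_def)
    then have "t powr (1 + s) = t * t powr s" by (simp add: powr_add)
    moreover have "(p1 / p0) powr (1 + s) = p1 / p0 * exp (s * l)"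
      using p by (simp add: powr_def exp_add distrib_right)
    moreover have "(1 - p0) * t = 1 - p1" using p by (simp add: t_def)
    ultimately show ?thesis
      using p unfolding lr_moment_def t_def[symmetric] by (simp add: mult.assoc[symmetric])
  qed
  have "p1 * l\<^sup>2 \<le> 2 * h * (1 + l)"
  proof -
    have "p1 * l \<le> (p1 - p0) * (1 + l)"
    proof -
      have "p0 * l \<le> p0 * (p1 / p0 - 1)" using p by (intro mult_left_mono ln_le_minus_one) auto
      then show ?thesis using p by (simp add: algebra_simps)
    qed
    then have "p1 * l * l \<le> (p1 - p0) * (1 + l) * l" using l_pos by (intro mult_right_mono) auto
    also have "\<dots> = ((p1 - p0) * l / 2) * (2 * (1 + l))" by simp
    also have "\<dots> \<le> h * (2 * (1 + l))" using l_pos by (intro mult_right_mono entropy_ge) auto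
    finally show ?thesis by (simp add: power2_eq_square algebra_simps)
  qed
  then have "s\<^sup>2 * exp (s * l) / 2 * (p1 * l\<^sup>2) \<le> s\<^sup>2 * exp (s * l) / 2 * (2 * h * (1 + l))"
    by (intro mult_left_mono) auto
  moreover have "p1 * exp (s * l) \<le> p1 * (1 + s * l + (s * l)\<^sup>2 * exp (s * l) / 2)"
    using p assms l_pos by (intro mult_left_mono exp_le_quadratic_nonneg) auto
  ultimately have up: "p1 * exp (s * l) \<le> p1 + s * (p1 * l) + s\<^sup>2 * h * (1 + l) * exp (s * l)"
    by (simp add: algebra_simps power_mult_distrib)
  have down: "(1 - p1) * t powr s \<le> (1 - p1) + s * ((1 - p1) * ln t) + s\<^sup>2 * h * (8 / (1 - c))"
  \<comment> \<open>For \<open>p1 = 1\<close> the ratio \<open>t\<close> is 0 and its logarithm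
    carries no information, but every such term has the factor \<open>1 - p1 = 0\<close>.\<close>
  proof (cases "p1 = 1")
    case True
    then show ?thesis using h_nonneg assms by simp
  next
    case False
    then have t: "0 < t" "t \<le> 1" "1 - p1 = (1 - p0) * t" "(1 - p0) * (1 - t) = p1 - p0"
      using p by (simp_all add: t_def field_simps)
    have "(1 - p1) * (ln t)\<^sup>2 = (1 - p0) * (t * (ln t)\<^sup>2)" using t by simp
    also have "\<dots> \<le> (1 - p0) * (4 * (1 - t)\<^sup>2)"
      using p t by (intro mult_left_mono mult_ln_squared_le) auto
    also have "\<dots> = 4 * (p1 - p0)\<^sup>2 / (1 - p0)"
      using p by (simp add: t(4)[symmetric] power2_eq_square)
    also have "\<dots> \<le> 8 * h / (1 - p0)"
    proof -
      have "p1 * l \<le> 1 * l" using p l_pos by (intro mult_right_mono) auto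
      then have "(p1 - p0) * (p1 - p0) \<le> (p1 - p0) * l"
        using p diff_le_p1_l by (intro mult_left_mono) linarith+
      then have "4 * (p1 - p0)\<^sup>2 \<le> 8 * h" using entropy_ge by (simp add: power2_eq_square)
      then show ?thesis using p by (intro divide_right_mono) auto
    qed
    also have "\<dots> \<le> 8 * h / (1 - c)"
      using assms p h_nonneg by (intro divide_left_mono) auto
    finally have "s\<^sup>2 * ((1 - p1) * (ln t)\<^sup>2) \<le> s\<^sup>2 * (8 * h / (1 - c))"
      by (intro mult_left_mono) auto
    moreover have "(1 - p1) * exp (s * ln t) \<le> (1 - p1) * (1 + s * ln t + (s * ln t)\<^sup>2)"
      using p t assms by (intro mult_left_mono exp_le_quadratic_nonpos) (auto simp: mult_nonneg_nonpos)
    ultimately show ?thesis using t(1)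
      by (simp add: algebra_simps power_mult_distrib powr_def)
  qed
  \<comment> \<open>The remainder of an absent edge lacks this factor; inserting it puts both
    remainders into one form.\<close>
  have "1 \<le> (1 + l) * exp (s * l)"
    using l_pos assms by (simp add: mult_ge1_I)
  then have "s\<^sup>2 * h * (8 / (1 - c)) * 1 \<le> s\<^sup>2 * h * (8 / (1 - c)) * ((1 + l) * exp (s * l))"
    using assms h_nonneg by (intro mult_left_mono) auto
  moreover have "s * h = s * (p1 * l) + s * ((1 - p1) * ln t)"
    by (simp add: bernoulli_entropy_def t_def distrib_left)
  moreover have "1 + s * h * (1 + (1 + 8 / (1 - c)) * s * (1 + l) * exp (s * l))
      = 1 + s * h + s\<^sup>2 * h * (1 + l) * exp (s * l) + s\<^sup>2 * h * (8 / (1 - c)) * ((1 + l) * exp (s * l))"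
    by (simp add: algebra_simps power2_eq_square add_divide_distrib)
  ultimately show ?thesis using up down mom by linarith
qed

text \<open>The added term is the chi-square divergence of the two Bernoulli laws.\<close>

lemma lr_moment_2: "mom 2 = 1 + (p1 - p0)\<^sup>2 / (p0 * (1 - p0))"
proof -
  have "mom 2 = p1\<^sup>2 / p0 + (1 - p1)\<^sup>2 / (1 - p0)"
    using p0_gt_0 p0_lt_p1 p1_le_1 by (simp add: lr_moment_def power2_eq_square)
  then show ?thesis
    using p0_gt_0 p0_lt_p1 p1_le_1 by (simp add: divide_simps) (simp add: algebra_simps power2_eq_square)
qed

end

text \<open>
  Here \<open>exp (- x)\<close> stands for \<open>k / n\<close> and \<open>lam\<close> for \<open>ln (N / n)\<close>. The left-hand side of the conclusion is the
  logarithm, divided by \<open>k\<close>, of the bound on the \<open>k\<close>-th summand.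
\<close>

lemma exponent_choice:
  fixes lam :: real
  assumes eps: "0 < \<epsilon>" "\<epsilon> < 1" and C: "0 \<le> C" and L: "0 \<le> L" and lam: "0 < lam" and M: "0 \<le> M"
    and x: "0 \<le> x" "x - lam \<le> - (M + 2)"
    and \<rho>: "\<rho> = 4 / \<epsilon> * (1 + L) / lam" "\<rho> \<le> 1 / 2"
    and M_small: "4 / \<epsilon> * (M + 1) / lam \<le> 1 / 2"
    and C_small: "C * (\<rho> * (M + 3) * exp (\<rho> * (M + 1))) \<le> \<epsilon> / 2"
    and s1: "exp (- (\<epsilon> / 8 * lam)) * lam * (1 + C * (1 + L) * exp L) \<le> 1"
  shows "\<exists>s. 0 \<le> s \<and> s \<le> 1 \<and>
    1 + x - s * lam + exp (- x) * (1 - \<epsilon>) * lam * s * (1 + C * s * (1 + L) * exp (s * L)) \<le> - M"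
\<comment> \<open>In the first case \<open>k / n\<close> is at most
  \<open>(n / N) powr (\<epsilon> / 8)\<close>, so with exponent 1 the entropy term is at most 1,
  and the slack \<open>M + 2\<close> absorbs it together with the leading 1.\<close>
proof (cases "\<epsilon> / 8 * lam \<le> x")
  case True
  let ?R = "lam * (1 + C * (1 + L) * exp L)"
  have R: "0 \<le> ?R" using lam C L by simp
  have "exp (- x) * (1 - \<epsilon>) * ?R \<le> exp (- (\<epsilon> / 8 * lam)) * 1 * ?R"
    using True eps R by (intro mult_right_mono mult_mono) auto
  also have "\<dots> \<le> 1" using s1 by (simp add: mult.assoc)
  finally have "exp (- x) * (1 - \<epsilon>) * ?R \<le> 1" .
  then show ?thesis using x by (intro exI[of _ 1]) (auto simp: mult.assoc)
next
  case False
  \<comment> \<open>Here \<open>z\<close> is the amount \<open>1 + x + M\<close> that has to be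
    gained. The factor \<open>4 / \<epsilon>\<close> makes the net gain
    \<open>\<epsilon> / 2 * s * lam\<close> equal to \<open>2 * z\<close>, and
    \<open>x < \<epsilon> / 8 * lam\<close> with \<open>M_small\<close> keeps \<open>s\<close> at
    most 1.\<close>
  define z where "z = x + (M + 1)"
  define s where "s = 4 / \<epsilon> * z / lam"
  have z: "0 \<le> z" using x M by (simp add: z_def)
  have s0: "0 \<le> s" using z eps lam by (simp add: s_def)
  have "s = 4 / \<epsilon> * x / lam + 4 / \<epsilon> * (M + 1) / lam"
    by (simp add: s_def z_def add_divide_distrib distrib_left)
  moreover have "4 / \<epsilon> * x / lam \<le> 1 / 2" using False eps lam by (simp add: field_simps)
  ultimately have s_le: "s \<le> 1" using M_small by linarith
  have slam: "s * lam = 4 / \<epsilon> * z" using lam by (simp add: s_def)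
  have sL: "s * (1 + L) = \<rho> * z" by (simp add: s_def \<rho>)
  have \<rho>0: "0 \<le> \<rho>" using eps L lam by (simp add: \<rho>)
  \<comment> \<open>As \<open>\<rho> \<le> 1 / 2\<close>, the growth of \<open>exp (s * L)\<close>
    costs only half of the decay \<open>exp (- x)\<close>; the other half bounds \<open>z\<close>
    uniformly in \<open>x\<close>.\<close>
  have "exp (- x) * (z * exp (s * L)) \<le> (M + 3) * exp (\<rho> * (M + 1))"
  proof -
    have "s * L \<le> \<rho> * x + \<rho> * (M + 1)" using sL s0 by (simp add: z_def algebra_simps)
    also have "\<dots> \<le> x / 2 + \<rho> * (M + 1)"
      using mult_right_mono[OF \<rho>(2) x(1)] by simp
    finally have "exp (- x) * exp (s * L) \<le> exp (- x) * exp (x / 2 + \<rho> * (M + 1))"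
      by (intro mult_left_mono) auto
    also have "\<dots> = exp (- (x / 2)) * exp (\<rho> * (M + 1))" by (simp add: exp_add[symmetric])
    finally have "z * (exp (- x) * exp (s * L)) \<le> z * (exp (- (x / 2)) * exp (\<rho> * (M + 1)))"
      using z by (intro mult_left_mono) auto
    moreover have "z * exp (- (x / 2)) \<le> M + 3"
    proof -
      have "x * exp (- (x / 2)) \<le> 2"
        using exp_ge_add_one_self[of "x / 2"] by (simp add: exp_minus field_simps)
      moreover have "(M + 1) * exp (- (x / 2)) \<le> (M + 1) * 1"
        using x M by (intro mult_left_mono) auto
      ultimately show ?thesis by (simp add: z_def distrib_right)
    qed
    then have "z * exp (- (x / 2)) * exp (\<rho> * (M + 1)) \<le> (M + 3) * exp (\<rho> * (M + 1))"
      by (intro mult_right_mono) auto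
    moreover have "exp (- x) * (z * exp (s * L)) = z * (exp (- x) * exp (s * L))" by simp
    ultimately show ?thesis by linarith
  qed
  then have "C * \<rho> * (exp (- x) * (z * exp (s * L))) \<le> C * \<rho> * ((M + 3) * exp (\<rho> * (M + 1)))"
    using C \<rho>0 by (intro mult_left_mono) auto
  also have "\<dots> \<le> \<epsilon> / 2" using C_small by (simp add: mult.assoc)
  finally have "exp (- x) * (C * (s * (1 + L)) * exp (s * L)) \<le> \<epsilon> / 2"
    unfolding sL by (simp add: mult_ac)
  moreover have "exp (- x) \<le> 1" using x by simp
  ultimately have "exp (- x) + exp (- x) * (C * (s * (1 + L)) * exp (s * L)) \<le> 1 + \<epsilon> / 2"
    by linarith
  then have "exp (- x) * (1 + C * (s * (1 + L)) * exp (s * L)) \<le> 1 + \<epsilon> / 2"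
    by (simp only: distrib_left[of "exp (- x)" 1] mult_1_right)
  then have "(1 - \<epsilon>) * (s * lam) * (exp (- x) * (1 + C * (s * (1 + L)) * exp (s * L)))
      \<le> (1 - \<epsilon>) * (s * lam) * (1 + \<epsilon> / 2)"
    using eps s0 lam by (intro mult_left_mono) auto
  also have "\<dots> = (1 - \<epsilon> / 2 - \<epsilon> * \<epsilon> / 2) * (s * lam)" by (simp add: algebra_simps)
  also have "\<dots> \<le> (1 - \<epsilon> / 2) * (s * lam)"
    using s0 lam eps by (intro mult_right_mono) auto
  also have "\<dots> = s * lam - 2 * z" using eps by (simp add: slam left_diff_distrib diff_divide_distrib)
  finally have "1 + x - s * lam + exp (- x) * (1 - \<epsilon>) * lam * s * (1 + C * s * (1 + L) * exp (s * L)) \<le> - M"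
    using x M by (simp add: mult_ac z_def)
  then show ?thesis using s0 s_le by blast
qed

subsection \<open>Asymptotics\<close>

lemma sum_power_le:
  fixes q :: real
  assumes "0 \<le> q" "q \<le> 1 / 2"
  shows "(\<Sum>k=1..n. q ^ k) \<le> 2 * q"
proof -
  \<comment> \<open>The remainder term strengthens the claim so that induction applies.\<close>
  have "(\<Sum>k=1..n. q ^ k) + 2 * q ^ Suc n \<le> 2 * q"
  proof (induction n)
    case (Suc n)
    have "2 * q * q ^ Suc n \<le> 1 * q ^ Suc n" using assms by (intro mult_right_mono) auto
    then show ?case using Suc by simp
  qed auto
  then show ?thesis using assms by (smt (verit) zero_le_power)
qed

context planted_community
begin

text \<open>Combines the bounds on the binomial, on the level and on the edge moment. The 2 in the
  scan condition cancels against \<open>k choose 2 \<le> k^2 / 2\<close>, leaving the factor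
  \<open>k / n = exp (- x)\<close>.\<close>

lemma weight_le:
  fixes n k :: nat
  assumes k: "1 \<le> k" "k \<le> n" and n: "n \<le> N" and s: "0 \<le> s" and c: "p0 \<le> c" "c < 1"
    and scan: "real n * h \<le> 2 * (1 - \<epsilon>) * lam" and lam: "lam = ln (real N / real n)"
    and x: "x = ln (real n / real k)"
  shows "real (n choose k) * (((real N / real n) ^ k) powr - s * mom (1 + s) ^ (k choose 2))
    \<le> exp (real k * (1 + x - s * lam +
          exp (- x) * (1 - \<epsilon>) * lam * s * (1 + (1 + 8 / (1 - c)) * s * (1 + l) * exp (s * l))))"
proof -
  define Q where "Q = 1 + (1 + 8 / (1 - c)) * s * (1 + l) * exp (s * l)"
  have Q: "0 \<le> Q" using s c l_pos by (simp add: Q_def)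
  have ux: "exp (- x) = real k / real n" using k by (simp add: x exp_minus)
  have level: "((real N / real n) ^ k) powr - s = exp (- (real k * s * lam))"
    using k n by (simp add: lam powr_def ln_realpow)
  have "mom (1 + s) \<le> exp (s * h * Q)"
    using lr_moment_le[OF s c, folded Q_def] exp_ge_add_one_self[of "s * h * Q"] by linarith
  then have "mom (1 + s) ^ (k choose 2) \<le> exp (s * h * Q) ^ (k choose 2)"
    using p0_gt_0 p0_lt_p1 p1_le_1 by (intro power_mono lr_moment_nonneg) auto
  also have "\<dots> = exp (real (k choose 2) * (s * h * Q))" by (simp add: exp_of_nat_mult)
  also have "real (k choose 2) * (s * h * Q) \<le> real k * (exp (- x) * (1 - \<epsilon>) * lam * s * Q)"
  proof -
    have "2 * (k choose 2) \<le> k * k" unfolding choose_two by (simp add: diff_mult_distrib2)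
    then have "real (2 * (k choose 2)) \<le> real (k * k)" by (simp only: of_nat_le_iff)
    then have "real (k choose 2) * (s * h * Q) \<le> real k * real k / 2 * (s * h * Q)"
      using s h_nonneg Q by (intro mult_right_mono) auto
    also have "\<dots> = real k * (real k / real n) * (real n * h) / 2 * (s * Q)" using k by simp
    also have "\<dots> \<le> real k * (real k / real n) * (2 * (1 - \<epsilon>) * lam) / 2 * (s * Q)"
      using s Q scan by (intro mult_right_mono divide_right_mono mult_left_mono) auto
    also have "\<dots> = real k * (exp (- x) * (1 - \<epsilon>) * lam * s * Q)"
      using k by (simp add: ux field_simps)
    finally show ?thesis .
  qed
  finally have "mom (1 + s) ^ (k choose 2) \<le> exp (real k * (exp (- x) * (1 - \<epsilon>) * lam * s * Q))"
    by simp
  then have "real (n choose k) * (((real N / real n) ^ k) powr - s * mom (1 + s) ^ (k choose 2))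
    \<le> exp (real k * (1 + x)) * (exp (- (real k * s * lam)) *
        exp (real k * (exp (- x) * (1 - \<epsilon>) * lam * s * Q)))"
    unfolding level x using binomial_le_exp[OF k]
    using p0_gt_0 p0_lt_p1 p1_le_1
    by (intro mult_mono mult_left_mono mult_nonneg_nonneg zero_le_power lr_moment_nonneg) auto
  also have "\<dots> = exp (real k * (1 + x - s * lam + exp (- x) * (1 - \<epsilon>) * lam * s * Q))"
    by (simp add: exp_add[symmetric] algebra_simps)
  finally show ?thesis by (simp add: Q_def)
qed

text \<open>The bound for a single \<open>N\<close>: each numerical hypothesis is one that holds for
  all large \<open>N\<close> once \<open>M\<close> and \<open>\<delta>\<close> are fixed.\<close>

lemma risk_lower_bound:
  fixes n :: nat
  assumes n: "0 < n" "n \<le> N" and c: "p0 \<le> c" "c < 1" and eps: "0 < \<epsilon>" "\<epsilon> < 1"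
    and lam: "lam = ln (real N / real n)" "0 < lam"
    and scan: "real n * h \<le> 2 * (1 - \<epsilon>) * lam" and M: "1 \<le> M"
    and \<rho>: "\<rho> = 4 / \<epsilon> * (1 + l) / lam" "\<rho> \<le> 1 / 2"
    and M_small: "4 / \<epsilon> * (M + 1) / lam \<le> 1 / 2"
    and C_small: "(1 + 8 / (1 - c)) * (\<rho> * (M + 3) * exp (\<rho> * (M + 1))) \<le> \<epsilon> / 2"
    and s1: "exp (- (\<epsilon> / 8 * lam)) * lam * (1 + (1 + 8 / (1 - c)) * (1 + l) * exp l) \<le> 1"
    and \<delta>: "0 \<le> \<delta>"
    and deg: "(exp (M + 2) * (real n)\<^sup>2 / real N)\<^sup>2 * ((p1 - p0)\<^sup>2 / (p0 * (1 - p0))) \<le> ln (1 + \<delta>)"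
    and r: "0 < r" and T: "T \<in> tests N"
  shows "1 - r - (\<delta> + 6 * exp (- M)) / (4 * r) \<le> risk N n p0 p1 T"
proof -
  \<comment> \<open>With this threshold, \<open>thr \<le> k\<close> says exactly that
    \<open>x - lam \<le> - (M + 2)\<close>.\<close>
  define thr where "thr = exp (M + 2) * (real n)\<^sup>2 / real N"
  have thr: "0 < thr" using n by (simp add: thr_def)
  have "\<exists>s. 0 \<le> s \<and> s \<le> 1 \<and> (1 \<le> k \<and> k \<le> n \<and> thr \<le> real k \<longrightarrow>
      real (n choose k) * (((real N / real n) ^ k) powr - s * mom (1 + s) ^ (k choose 2))
        \<le> exp (- M) ^ k)" for k
  proof (cases "1 \<le> k \<and> k \<le> n \<and> thr \<le> real k")
    case True
    define x where "x = ln (real n / real k)"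
    have "0 \<le> x" using True by (simp add: x_def)
    moreover have "x - lam \<le> - (M + 2)"
    proof -
      have "exp (M + 2) \<le> real k * real N / (real n)\<^sup>2"
        using True n by (simp add: thr_def field_simps)
      then have "M + 2 \<le> ln (real k * real N / (real n)\<^sup>2)"
        using True n by (subst ln_ge_iff) auto
      then show ?thesis
        using True n by (simp add: x_def lam ln_div ln_mult ln_realpow)
    qed
    ultimately obtain s where s: "0 \<le> s" "s \<le> 1" and e: "1 + x - s * lam + exp (- x) * (1 - \<epsilon>) * lam *
        s * (1 + (1 + 8 / (1 - c)) * s * (1 + l) * exp (s * l)) \<le> - M"
      using exponent_choice[of \<epsilon> "1 + 8 / (1 - c)" l lam M x \<rho>] eps c l_pos lam(2) M \<rho> M_small C_small s1
      by auto
    have "real (n choose k) * (((real N / real n) ^ k) powr - s * mom (1 + s) ^ (k choose 2))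
        \<le> exp (real k * - M)"
    proof (rule order_trans[OF weight_le[OF _ _ n(2) s(1) c scan lam(1) x_def]])
      show "exp (real k * (1 + x - s * lam + exp (- x) * (1 - \<epsilon>) * lam * s *
          (1 + (1 + 8 / (1 - c)) * s * (1 + l) * exp (s * l)))) \<le> exp (real k * - M)"
        using mult_left_mono[OF e, of "real k"] by (simp only: exp_le_cancel_iff of_nat_0_le_iff)
    qed (use True in auto)
    then show ?thesis unfolding exp_of_nat_mult using s by blast
  next
    case False
    \<comment> \<open>The locale wants an exponent between 0 and 1 for every \<open>k\<close>;
      outside the relevant range any such value will do.\<close>
    then show ?thesis by (intro exI[of _ 1]) auto
  qed
  then obtain s where s: "0 \<le> s k" "s k \<le> 1"
    and w: "1 \<le> k \<Longrightarrow> k \<le> n \<Longrightarrow> thr \<le> real k \<Longrightarrow>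
      real (n choose k) * (((real N / real n) ^ k) powr - s k * mom (1 + s k) ^ (k choose 2))
        \<le> exp (- M) ^ k" for k
    by metis
  interpret truncated_community N p0 p1 n thr s
    using n thr s by unfold_locales
  have "tail_mass \<le> (\<Sum>k\<in>{k. k \<le> n \<and> thr \<le> real k}. exp (- M) ^ k)"
    unfolding tail_mass_def
  proof (intro sum_mono)
    fix k assume "k \<in> {k. k \<le> n \<and> thr \<le> real k}"
    moreover from this have "1 \<le> k" using thr by (cases k) auto
    ultimately show "real (n choose k) * tail_weight k \<le> exp (- M) ^ k"
      using w[of k] by (simp add: tail_weight_def)
  qed
  also have "\<dots> \<le> (\<Sum>k=1..n. exp (- M) ^ k)"
  proof (intro sum_mono2)
    show "{k. k \<le> n \<and> thr \<le> real k} \<subseteq> {1..n}"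
    proof
      fix k assume "k \<in> {k. k \<le> n \<and> thr \<le> real k}"
      then show "k \<in> {1..n}" using thr by (cases k) auto
    qed
  qed auto
  also have "\<dots> \<le> 2 * exp (- M)"
  proof (intro sum_power_le)
    have "2 \<le> exp M" using exp_ge_add_one_self[of M] M by linarith
    then show "exp (- M) \<le> 1 / 2" by (simp add: exp_minus field_simps)
  qed auto
  finally have tail: "tail_mass \<le> 2 * exp (- M)" .
  have small: "mom 2 ^ (k choose 2) \<le> 1 + \<delta>" if k: "k \<le> n" "real k < thr" for k
  proof -
    define D where "D = (p1 - p0)\<^sup>2 / (p0 * (1 - p0))"
    have D: "0 \<le> D" using p0_gt_0 p0_lt_p1 p1_le_1 by (simp add: D_def)
    have "mom 2 ^ (k choose 2) \<le> exp D ^ (k choose 2)"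
      using D unfolding lr_moment_2 D_def[symmetric]
      by (intro power_mono) (auto simp: exp_ge_add_one_self)
    also have "\<dots> = exp (real (k choose 2) * D)" by (simp add: exp_of_nat_mult)
    also have "real (k choose 2) * D \<le> thr\<^sup>2 * D"
    proof (intro mult_right_mono D)
      have "k choose 2 \<le> k * k" unfolding choose_two by (simp add: diff_mult_distrib2)
      then have "real (k choose 2) \<le> real k * real k" by (metis of_nat_le_iff of_nat_mult)
      also have "\<dots> \<le> thr * thr" using k by (intro mult_mono) auto
      finally show "real (k choose 2) \<le> thr\<^sup>2" by (simp add: power2_eq_square)
    qed
    also have "thr\<^sup>2 * D \<le> ln (1 + \<delta>)" using deg by (simp add: thr_def D_def)
    finally show ?thesis using \<delta> by simp
  qed
  have "1 - r - (\<delta> + 3 * tail_mass) / (4 * r) \<le> risk N n p0 p1 T"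
    by (rule risk_ge[OF T r small \<delta>])
  moreover have "(\<delta> + 3 * tail_mass) / (4 * r) \<le> (\<delta> + 6 * exp (- M)) / (4 * r)"
    using tail r by (intro divide_right_mono) auto
  ultimately show ?thesis by linarith
qed

text \<open>If \<open>l > 2\<close>, then \<open>p1 - p0 \<ge> p1 / 2\<close>, so
  \<open>h \<ge> p1 / 2\<close> and the scan condition forces \<open>n * p1 \<le> 4 * lam\<close>;
  dividing by \<open>n * p0\<close> bounds \<open>p1 / p0\<close>.\<close>

lemma log_ratio_le:
  assumes n: "0 < n" and scan: "real n * h \<le> 2 * lam" and lam: "1 \<le> lam"
  shows "l \<le> 2 + ln (4 * lam) + ln (max 1 (1 / (real n * p0)))"
proof (cases "l \<le> 2")
  case True
  moreover have "0 \<le> ln (4 * lam)" "0 \<le> ln (max 1 (1 / (real n * p0)))"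
    using lam by (auto intro!: ln_ge_zero)
  ultimately show ?thesis by linarith
next
  case False
  have p: "0 < p0" "p0 < p1" "p1 \<le> 1" using p0_gt_0 p0_lt_p1 p1_le_1 by auto
  have "exp 1 \<le> exp l" using False by simp
  then have "2 \<le> p1 / p0" using exp_ge_add_one_self[of 1] p by simp
  then have a: "p1 / 2 \<le> p1 - p0" using p by (simp add: field_simps)
  have "p1 / 2 * 2 / 2 \<le> (p1 - p0) * l / 2"
    using a False p by (intro divide_right_mono mult_mono) auto
  also note entropy_ge
  finally have "real n * (p1 / 2) \<le> real n * h" by (intro mult_left_mono) auto
  then have np1: "real n * p1 \<le> 4 * lam" using scan by simp
  have "p1 / p0 = (real n * p1) * (1 / (real n * p0))" using n by simp
  also have "\<dots> \<le> 4 * lam * max 1 (1 / (real n * p0))"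
    using p lam by (intro mult_mono[OF np1]) auto
  finally have "l \<le> ln (4 * lam * max 1 (1 / (real n * p0)))"
    using p lam by (subst ln_le_cancel_iff) auto
  also have "\<dots> = ln (4 * lam) + ln (max 1 (1 / (real n * p0)))"
    using lam by (intro ln_mult_pos) auto
  finally show ?thesis by simp
qed

end

text \<open>The test that never rejects has risk exactly 1.\<close>

lemma INF_risk_le_1:
  assumes "n \<le> N"
  shows "(INF T\<in>tests N. risk N n p0 p1 T) \<le> 1"
proof -
  have ne: "{S. S \<subseteq> {1..N} \<and> card S = n} \<noteq> {}"
    using assms obtain_subset_with_card_n[of n "{1..N}"] by auto
  have "(\<lambda>_. 0) \<in> tests N" by (auto simp: tests_def)
  then have "(INF T\<in>tests N. risk N n p0 p1 T) \<le> risk N n p0 p1 (\<lambda>_. 0)"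
    by (intro cINF_lower bdd_below_risk assms)
  also have "\<dots> = 1" using ne by (auto simp: risk_def image_constant_conv)
  finally show ?thesis .
qed

lemma limsup_less_1E:
  fixes f :: "nat \<Rightarrow> real"
  assumes "limsup (\<lambda>N. ereal (f N)) < 1"
  obtains \<epsilon> where "0 < \<epsilon>" "\<epsilon> < 1" "eventually (\<lambda>N. f N \<le> 1 - \<epsilon>) sequentially"
proof -
  obtain y where y: "limsup (\<lambda>N. ereal (f N)) < ereal y" "ereal y < 1"
    using ereal_dense2[OF assms] by blast
  have "eventually (\<lambda>N. ereal (f N) < ereal y) sequentially"
    using y(1) by (rule Limsup_lessD)
  \<comment> \<open>The minimum with \<open>1 / 2\<close> keeps \<open>\<epsilon>\<close> below 1
    even if \<open>y\<close> is negative.\<close>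
  then have "eventually (\<lambda>N. f N \<le> 1 - min (1 - y) (1 / 2)) sequentially"
    by eventually_elim auto
  moreover have "y < 1" using y(2) by simp
  ultimately show ?thesis by (intro that[of "min (1 - y) (1 / 2)"]) auto
qed

theorem theorem2:
  fixes n :: "nat \<Rightarrow> nat" and p0 p1 :: "nat \<Rightarrow> real"
  assumes p0_pos: "\<And>N. 0 < p0 N"
    and p0_less_p1: "\<And>N. p0 N < p1 N"
    and p1_le_1: "\<And>N. p1 N \<le> 1"
    and n_small: "(\<lambda>N. real (n N) / real N) \<longlonglongrightarrow> 0"
    and p0_away_from_1: "\<exists>c<1. \<forall>N. p0 N \<le> c"
    and N2p0: "filterlim (\<lambda>N. (real N)\<^sup>2 * p0 N) at_top sequentially"
    and n_at_top: "filterlim n at_top sequentially"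
    and n2p1: "filterlim (\<lambda>N. (real (n N))\<^sup>2 * p1 N) at_top sequentially"
    and n_over_log: "filterlim (\<lambda>N. real (n N) / ln (real N)) at_top sequentially"
    and log_cond: "(\<lambda>N. ln (max 1 (1 / (real (n N) * p0 N)))) \<in> o(\<lambda>N. ln (real N / real (n N)))"
    and total_degree_cond:
      "(\<lambda>N. (p1 N - p0 N) / sqrt (p0 N) * ((real (n N))\<^sup>2 / real N)) \<longlonglongrightarrow> 0"
    and scan_cond:
      "limsup (\<lambda>N. ereal (real (n N) * bernoulli_entropy (p0 N) (p1 N)
                           / (2 * ln (real N / real (n N))))) < 1"
  shows "(\<lambda>N. INF T\<in>tests N. risk N (n N) (p0 N) (p1 N) T) \<longlonglongrightarrow> 1"
proof -
  obtain c where c: "c < 1" "\<And>N. p0 N \<le> c" using p0_away_from_1 by blast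
  obtain \<epsilon> where eps: "0 < \<epsilon>" "\<epsilon> < 1"
    and scan: "eventually (\<lambda>N. real (n N) * bernoulli_entropy (p0 N) (p1 N)
        / (2 * ln (real N / real (n N))) \<le> 1 - \<epsilon>) sequentially"
    by (rule limsup_less_1E[OF scan_cond])
  define lam where "lam N = ln (real N / real (n N))" for N
  define l where "l N = ln (p1 N / p0 N)" for N
  define C where "C = 1 + 8 / (1 - c)"
  have C: "0 \<le> C" using c by (simp add: C_def)
  have model: "planted_community (p0 N) (p1 N)" for N
    using p0_pos p0_less_p1 p1_le_1 by unfold_locales
  have l_pos: "0 < l N" for N
    using planted_community.l_pos[OF model] by (simp add: l_def)

  \<comment> \<open>Growth of \<open>lam\<close> and the scan condition for large
    \<open>N\<close>\<close>
  have ev_n: "eventually (\<lambda>N. 0 < n N) sequentially"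
    using n_at_top eventually_gt_at_top[of 0] by (auto simp: filterlim_iff)
  have ev_N: "eventually (\<lambda>N. 0 < N) sequentially" by (rule eventually_gt_at_top)
  have "filterlim (\<lambda>N. inverse (real (n N) / real N)) at_top sequentially"
    by (intro filterlim_inverse_at_top n_small)
      (use ev_n ev_N in \<open>eventually_elim; simp\<close>)
  then have "filterlim (\<lambda>N. real N / real (n N)) at_top sequentially" by simp
  then have lam_top: "filterlim lam at_top sequentially"
    unfolding lam_def[abs_def] by (rule filterlim_compose[OF ln_at_top])
  have ev_lam: "eventually (\<lambda>N. 1 \<le> lam N) sequentially"
    using lam_top by (auto simp: filterlim_at_top)
  have ev_le: "eventually (\<lambda>N. n N \<le> N) sequentially"
  proof -
    have "eventually (\<lambda>N. real (n N) / real N < 1) sequentially"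
      using n_small by (rule order_tendstoD) simp
    then show ?thesis using ev_N by eventually_elim (simp add: field_simps)
  qed
  have ev_scan: "eventually (\<lambda>N. real (n N) * bernoulli_entropy (p0 N) (p1 N)
      \<le> 2 * (1 - \<epsilon>) * lam N) sequentially"
    using scan ev_lam by eventually_elim (simp add: lam_def field_simps)

  \<comment> \<open>The log ratio \<open>l\<close> is negligible against \<open>lam\<close>\<close>
  have l_lam: "(\<lambda>N. l N / lam N) \<longlonglongrightarrow> 0"
  proof (rule tendsto_sandwich)
    let ?u = "\<lambda>N. ln (max 1 (1 / (real (n N) * p0 N)))"
    show "eventually (\<lambda>N. 0 \<le> l N / lam N) sequentially"
      using ev_lam by eventually_elim (use l_pos in \<open>auto intro!: divide_nonneg_nonneg less_imp_le\<close>)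
    show "eventually (\<lambda>N. l N / lam N \<le> (2 + ln (4 * lam N)) / lam N + ?u N / lam N) sequentially"
      using ev_lam ev_n ev_scan
    proof eventually_elim
      case (elim N)
      have "(1 - \<epsilon>) * lam N \<le> 1 * lam N" using elim eps by (intro mult_right_mono) auto
      then have "real (n N) * bernoulli_entropy (p0 N) (p1 N) \<le> 2 * lam N" using elim by linarith
      then have "l N \<le> 2 + ln (4 * lam N) + ?u N"
        unfolding l_def using elim planted_community.log_ratio_le[OF model] by blast
      then have "l N / lam N \<le> (2 + ln (4 * lam N) + ?u N) / lam N"
        using elim by (intro divide_right_mono) auto
      then show ?case by (simp add: add_divide_distrib)
    qed
    have "((\<lambda>x::real. (2 + ln (4 * x)) / x) \<longlongrightarrow> 0) at_top" by real_asymp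
    then have "(\<lambda>N. (2 + ln (4 * lam N)) / lam N) \<longlonglongrightarrow> 0"
      using lam_top by (rule filterlim_compose)
    moreover have "(\<lambda>N. ?u N / lam N) \<longlonglongrightarrow> 0"
      using log_cond unfolding lam_def by (rule smalloD_tendsto)
    ultimately show "(\<lambda>N. (2 + ln (4 * lam N)) / lam N + ?u N / lam N) \<longlonglongrightarrow> 0"
      using tendsto_add by fastforce
  qed simp_all

  define \<rho> where "\<rho> N = 4 / \<epsilon> * (1 + l N) / lam N" for N
  have inv_lam: "(\<lambda>N. 1 / lam N) \<longlonglongrightarrow> 0"
    using lam_top by (auto intro: tendsto_divide_0 filterlim_at_top_imp_at_infinity)
  have \<rho>: "\<rho> \<longlonglongrightarrow> 0"
  proof -
    have "(\<lambda>N. 4 / \<epsilon> * (1 / lam N + l N / lam N)) \<longlonglongrightarrow> 4 / \<epsilon> * (0 + 0)"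
      by (intro tendsto_intros inv_lam l_lam)
    then show ?thesis by (simp add: \<rho>_def[abs_def] add_divide_distrib distrib_left)
  qed
  have ev_\<rho>: "eventually (\<lambda>N. \<rho> N \<le> 1 / 2) sequentially"
    using order_tendstoD(2)[OF \<rho>, of "1 / 2"] by (auto elim: eventually_mono)
  have ev_s1: "eventually (\<lambda>N. exp (- (\<epsilon> / 8 * lam N)) * lam N * (1 + C * (1 + l N) * exp (l N)) \<le> 1) sequentially"
  proof -
    \<comment> \<open>The choice \<open>\<epsilon> / 32\<close> bounds
      \<open>(1 + l) * exp l \<le> exp (2 * l)\<close> by half of the available exponent
      \<open>\<epsilon> / 8 * lam\<close>; the other half beats the factor
      \<open>lam\<close>.\<close>
    have "eventually (\<lambda>N. l N / lam N < \<epsilon> / 32) sequentially"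
      using eps by (intro order_tendstoD(2)[OF l_lam]) auto
    moreover have "((\<lambda>x::real. exp (- (\<epsilon> / 16 * x)) * x * (1 + C)) \<longlongrightarrow> 0) at_top"
      using eps by real_asymp
    then have "(\<lambda>N. exp (- (\<epsilon> / 16 * lam N)) * lam N * (1 + C)) \<longlonglongrightarrow> 0"
      using lam_top by (rule filterlim_compose)
    then have "eventually (\<lambda>N. exp (- (\<epsilon> / 16 * lam N)) * lam N * (1 + C) < 1) sequentially"
      by (rule order_tendstoD) simp
    ultimately show ?thesis using ev_lam
    proof eventually_elim
      case (elim N)
      have "(1 + l N) * exp (l N) \<le> exp (l N) * exp (l N)"
        by (intro mult_right_mono) (auto simp: exp_ge_add_one_self)
      also have "\<dots> = exp (2 * l N)" by (simp add: exp_add[symmetric])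
      also have "\<dots> \<le> exp (\<epsilon> / 16 * lam N)" using elim by (simp add: field_simps)
      finally have "C * ((1 + l N) * exp (l N)) \<le> C * exp (\<epsilon> / 16 * lam N)"
        using C by (rule mult_left_mono)
      moreover have "1 \<le> exp (\<epsilon> / 16 * lam N)" using elim eps by simp
      ultimately have "1 + C * ((1 + l N) * exp (l N))
          \<le> exp (\<epsilon> / 16 * lam N) + C * exp (\<epsilon> / 16 * lam N)"
        by linarith
      then have "1 + C * (1 + l N) * exp (l N) \<le> (1 + C) * exp (\<epsilon> / 16 * lam N)"
        by (simp only: distrib_right[of 1 C] mult.assoc mult_1_left)
      then have "exp (- (\<epsilon> / 8 * lam N)) * lam N * (1 + C * (1 + l N) * exp (l N))
          \<le> exp (- (\<epsilon> / 8 * lam N)) * lam N * ((1 + C) * exp (\<epsilon> / 16 * lam N))"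
        using elim by (intro mult_left_mono) auto
      also have "\<dots> = (exp (- (\<epsilon> / 8 * lam N)) * exp (\<epsilon> / 16 * lam N)) * lam N * (1 + C)"
        by (simp add: mult_ac)
      also have "exp (- (\<epsilon> / 8 * lam N)) * exp (\<epsilon> / 16 * lam N) = exp (- (\<epsilon> / 16 * lam N))"
        by (simp add: exp_add[symmetric])
      finally show ?case using elim by linarith
    qed
  qed

  \<comment> \<open>Lower bound on the minimal risk\<close>
  have main: "eventually (\<lambda>N. 1 - e \<le> (INF T\<in>tests N. risk N (n N) (p0 N) (p1 N) T)) sequentially"
    if e: "0 < e" for e
  proof -
    \<comment> \<open>These choices give \<open>\<delta> + 6 * exp (- M) \<le> e^2\<close>; with
      \<open>r = e / 2\<close> the quotient in \<open>risk_lower_bound\<close> is at most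
      \<open>e / 2\<close>, for a total loss of \<open>e\<close>.\<close>
    define M where "M = max 1 (- ln (e\<^sup>2 / 12))"
    define \<delta> where "\<delta> = e\<^sup>2 / 2"
    have M: "1 \<le> M" by (simp add: M_def)
    have "exp (- M) \<le> exp (ln (e\<^sup>2 / 12))" by (simp add: M_def)
    then have expM: "exp (- M) \<le> e\<^sup>2 / 12" using e by simp
    have \<delta>: "0 < \<delta>" using e by (simp add: \<delta>_def)
    have "(\<lambda>N. 4 / \<epsilon> * (M + 1) * (1 / lam N)) \<longlonglongrightarrow> 4 / \<epsilon> * (M + 1) * 0"
      by (intro tendsto_intros inv_lam)
    then have "eventually (\<lambda>N. 4 / \<epsilon> * (M + 1) * (1 / lam N) < 1 / 2) sequentially"
      by (rule order_tendstoD) simp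
    moreover have "(\<lambda>N. C * (\<rho> N * (M + 3) * exp (\<rho> N * (M + 1)))) \<longlonglongrightarrow> C * (0 * (M + 3) * exp (0 * (M + 1)))"
      by (intro tendsto_intros \<rho>)
    then have "eventually (\<lambda>N. C * (\<rho> N * (M + 3) * exp (\<rho> N * (M + 1))) < \<epsilon> / 2) sequentially"
      by (rule order_tendstoD) (use eps in simp)
    moreover have "eventually (\<lambda>N. (exp (M + 2) * (real (n N))\<^sup>2 / real N)\<^sup>2 *
        ((p1 N - p0 N)\<^sup>2 / (p0 N * (1 - p0 N))) \<le> ln (1 + \<delta>)) sequentially"
    proof -
      \<comment> \<open>The required quantity is the square of the total degree expression times a
        constant over \<open>1 - p0\<close>, and \<open>1 - p0\<close> is at least
        \<open>1 - c\<close>.\<close>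
      let ?d = "\<lambda>N. (p1 N - p0 N) / sqrt (p0 N) * ((real (n N))\<^sup>2 / real N)"
      have "(\<lambda>N. (exp (M + 2))\<^sup>2 / (1 - c) * (?d N)\<^sup>2) \<longlonglongrightarrow> (exp (M + 2))\<^sup>2 / (1 - c) * 0\<^sup>2"
        by (intro tendsto_intros total_degree_cond)
      then have "eventually (\<lambda>N. (exp (M + 2))\<^sup>2 / (1 - c) * (?d N)\<^sup>2 < ln (1 + \<delta>)) sequentially"
        by (rule order_tendstoD) (use \<delta> in simp)
      then show ?thesis
      proof eventually_elim
        case (elim N)
        have "(exp (M + 2) * (real (n N))\<^sup>2 / real N)\<^sup>2 * ((p1 N - p0 N)\<^sup>2 / (p0 N * (1 - p0 N)))
            = (exp (M + 2))\<^sup>2 * (?d N)\<^sup>2 / (1 - p0 N)"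
          using p0_pos[of N] by (simp add: power_mult_distrib power_divide mult_ac)
        also have "\<dots> \<le> (exp (M + 2))\<^sup>2 * (?d N)\<^sup>2 / (1 - c)"
          using c p0_less_p1[of N] p1_le_1[of N] by (intro divide_left_mono) auto
        also have "\<dots> \<le> ln (1 + \<delta>)" using elim by simp
        finally show ?case .
      qed
    qed
    ultimately show ?thesis
      using ev_n ev_le ev_lam ev_scan ev_\<rho> ev_s1
    proof eventually_elim
      case (elim N)
      have bound: "1 - e / 2 - (\<delta> + 6 * exp (- M)) / (4 * (e / 2)) \<le> risk N (n N) (p0 N) (p1 N) T"
        if "T \<in> tests N" for T
        using elim c eps M \<delta> e that
        by (intro planted_community.risk_lower_bound[OF model, where c = c and \<epsilon> = \<epsilon> and lam = "lam N"
              and \<rho> = "\<rho> N"])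
          (auto simp: lam_def[symmetric] l_def[symmetric] C_def[symmetric] \<rho>_def)
      have "\<delta> + 6 * exp (- M) \<le> e * e" using expM by (simp add: \<delta>_def power2_eq_square)
      then have "(\<delta> + 6 * exp (- M)) / (4 * (e / 2)) \<le> e * e / (4 * (e / 2))"
        using e by (intro divide_right_mono) auto
      also have "\<dots> = e / 2" using e by simp
      finally have "1 - e \<le> 1 - e / 2 - (\<delta> + 6 * exp (- M)) / (4 * (e / 2))" by linarith
      then show ?case
        by (intro cINF_greatest order_trans[OF _ bound]) (auto simp: tests_def)
    qed
  qed

  show ?thesis
  proof (rule order_tendstoI)
    fix a :: real assume "a < 1"
    then have "eventually (\<lambda>N. 1 - (1 - a) / 2 \<le> (INF T\<in>tests N. risk N (n N) (p0 N) (p1 N) T)) sequentially"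
      by (intro main) simp
    then show "eventually (\<lambda>N. a < (INF T\<in>tests N. risk N (n N) (p0 N) (p1 N) T)) sequentially"
      by eventually_elim (use \<open>a < 1\<close> in \<open>simp add: field_simps\<close>)
  next
    fix a :: real assume "1 < a"
    show "eventually (\<lambda>N. (INF T\<in>tests N. risk N (n N) (p0 N) (p1 N) T) < a) sequentially"
      using ev_le by eventually_elim (use \<open>1 < a\<close> INF_risk_le_1 in \<open>fastforce intro: le_less_trans\<close>)
  qed
qed

end
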